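(* For any integer $s\geq 3$ and for any constant $c>0$ small enough (depending on $s$), we have, as $n\to\infty$, \[g(n;s,cn) = (1-o(1))\,\mathrm{RT}(s,cn,n).\]
   Context: A red/blue/purple colouring of $K_n$ is a partition $R\cup B\cup P$ of the edge set of $K_n$ into three graphs (red, blue, purple). For integers $s,t\ge 2$ and $n<R(s,t)$ (the classical Ramsey number), $g(n;s,t)$ is the largest integer $g$ such that there exists a red/blue/purple colouring $R\cup B\cup P$ of $K_n$ with $|P|=g$ such that $R\cup P$ contains no $K_s$ and $B\cup P$ contains no $K_t$. For non-integer $s,t$ one sets $g(n;s,t):=g(n;\lceil s\rceil,\lceil t\rceil)$. The Ramsey–Turán number $\mathrm{RT}(s,t,n)$ is the maximum number of edges in an $n$-vertex $K_s$-free graph $G$ with independence number $\alpha(G)<t$. Asymptotic notation refers to $n\to\infty$. *)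

theory Defs
  imports Complex_Main "HOL-Library.Ramsey" "HOL-Library.Landau_Symbols"
begin

text \<open>A graph on the vertex set \<open>{..<n}\<close> is given by its edge set, a subset of
  \<open>complete_edges n\<close>.\<close>

definition complete_edges :: "nat \<Rightarrow> nat set set" where
  "complete_edges n = [{..<n}]\<^bsup>2\<^esup>"

definition contains_K :: "nat \<Rightarrow> nat \<Rightarrow> nat set set \<Rightarrow> bool" where
  "contains_K n s E \<longleftrightarrow> (\<exists>S \<subseteq> {..<n}. card S = s \<and> clique S E)"

definition independence_number :: "nat \<Rightarrow> nat set set \<Rightarrow> nat" where
  "independence_number n E = Max {card S | S. S \<subseteq> {..<n} \<and> indep S E}"

definition ramsey_number :: "nat \<Rightarrow> nat \<Rightarrow> nat" where
  "ramsey_number s t = (LEAST N. \<forall>R B. R \<union> B = complete_edges N \<and> R \<inter> B = {} \<longrightarrow>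
      contains_K N s R \<or> contains_K N t B)"

definition rbp_colouring ::
  "nat \<Rightarrow> nat set set \<Rightarrow> nat set set \<Rightarrow> nat set set \<Rightarrow> bool" where
  "rbp_colouring n R B P \<longleftrightarrow>
     R \<union> B \<union> P = complete_edges n \<and> R \<inter> B = {} \<and> R \<inter> P = {} \<and> B \<inter> P = {}"

definition good_purple_sizes :: "nat \<Rightarrow> nat \<Rightarrow> nat \<Rightarrow> nat set" where
  "good_purple_sizes n s t = {card P | R B P. rbp_colouring n R B P \<and>
      \<not> contains_K n s (R \<union> P) \<and> \<not> contains_K n t (B \<union> P)}"

text \<open>The number \<open>g(n; s, t)\<close> for real \<open>s\<close>, \<open>t\<close>, which are rounded up.
  It is meaningful only if \<open>n < ramsey_number \<lceil>s\<rceil> \<lceil>t\<rceil>\<close>; otherwise the set of which the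
  maximum is taken is empty, see \<open>good_purple_sizes_nonempty_iff\<close> below.\<close>

definition g :: "nat \<Rightarrow> real \<Rightarrow> real \<Rightarrow> nat" where
  "g n s t = Max (good_purple_sizes n (nat \<lceil>s\<rceil>) (nat \<lceil>t\<rceil>))"

definition RT :: "nat \<Rightarrow> real \<Rightarrow> nat \<Rightarrow> nat" where
  "RT s t n = Max {card E | E. E \<subseteq> complete_edges n \<and> \<not> contains_K n s E \<and>
      real (independence_number n E) < t}"

lemma finite_complete_edges: "finite (complete_edges n)"
  by (simp add: complete_edges_def finite_imp_finite_nsets)

lemma finite_good_purple_sizes: "finite (good_purple_sizes n s t)"
proof (rule finite_subset)
  show "good_purple_sizes n s t \<subseteq> card ` Pow (complete_edges n)"
    by (auto simp: good_purple_sizes_def rbp_colouring_def)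
qed (simp add: finite_complete_edges)

lemma contains_K_restrict:
  assumes "m \<le> n" and "contains_K m s (R \<inter> complete_edges m)"
  shows "contains_K n s R"
proof -
  obtain S where S: "S \<subseteq> {..<m}" "card S = s" "clique S (R \<inter> complete_edges m)"
    using assms(2) unfolding contains_K_def by blast
  have "S \<subseteq> {..<n}" using S(1) assms(1) by auto
  moreover have "clique S R" using S(3) unfolding clique_def by blast
  ultimately show ?thesis using S(2) unfolding contains_K_def by blast
qed

lemma ramsey_number_exists:
  "\<exists>N. \<forall>R B. R \<union> B = complete_edges N \<and> R \<inter> B = {} \<longrightarrow> contains_K N s R \<or> contains_K N t B"
proof -
  obtain r where r: "\<And>(V::nat set) E. finite V \<Longrightarrow> card V \<ge> r \<Longrightarrow>
      \<exists>S \<subseteq> V. card S = s \<and> clique S E \<or> card S = t \<and> indep S E"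
    using ramsey2[where 'a = nat and m = s and n = t] by blast
  have "contains_K r s R \<or> contains_K r t B" if RB: "R \<union> B = complete_edges r" for R B
  proof -
    obtain S where S: "S \<subseteq> {..<r}" "card S = s \<and> clique S R \<or> card S = t \<and> indep S R"
      using r[of "{..<r}" R] by auto
    have "clique S B" if ind: "indep S R"
      unfolding clique_def
    proof (intro ballI impI)
      fix v w assume vw: "v \<in> S" "w \<in> S" "v \<noteq> w"
      then have "{v, w} \<in> complete_edges r"
        using S(1) by (auto simp: complete_edges_def nsets_def)
      then show "{v, w} \<in> B" using RB ind vw by (auto simp: indep_def)
    qed
    then show ?thesis using S by (auto simp: contains_K_def)
  qed
  then show ?thesis by blast
qed

lemma good_purple_sizes_nonempty_iff:
  "good_purple_sizes n s t \<noteq> {} \<longleftrightarrow> n < ramsey_number s t"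
proof
  assume "n < ramsey_number s t"
  then have "\<not> (\<forall>R B. R \<union> B = complete_edges n \<and> R \<inter> B = {} \<longrightarrow>
      contains_K n s R \<or> contains_K n t B)"
    unfolding ramsey_number_def by (rule not_less_Least)
  then obtain R B where "R \<union> B = complete_edges n" "R \<inter> B = {}"
      "\<not> contains_K n s R" "\<not> contains_K n t B"
    by auto
  then have "rbp_colouring n R B {}" "\<not> contains_K n s (R \<union> {})" "\<not> contains_K n t (B \<union> {})"
    by (auto simp: rbp_colouring_def)
  then show "good_purple_sizes n s t \<noteq> {}"
    unfolding good_purple_sizes_def by blast
next
  assume "good_purple_sizes n s t \<noteq> {}"
  then obtain R B P where c: "rbp_colouring n R B P"
      and R: "\<not> contains_K n s (R \<union> P)" and B: "\<not> contains_K n t (B \<union> P)"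
    by (auto simp: good_purple_sizes_def)
  have B': "\<not> contains_K n t B"
  proof
    assume "contains_K n t B"
    then obtain S where "S \<subseteq> {..<n}" "card S = t" "clique S B"
      unfolding contains_K_def by blast
    moreover from \<open>clique S B\<close> have "clique S (B \<union> P)" unfolding clique_def by blast
    ultimately show False using B unfolding contains_K_def by blast
  qed
  show "n < ramsey_number s t"
  proof (rule ccontr)
    define m where "m = ramsey_number s t"
    assume "\<not> n < ramsey_number s t"
    then have m: "m \<le> n" by (simp add: m_def)
    then have sub: "complete_edges m \<subseteq> complete_edges n"
      unfolding complete_edges_def by (intro nsets_mono) auto
    have "\<forall>R B. R \<union> B = complete_edges m \<and> R \<inter> B = {} \<longrightarrow>
        contains_K m s R \<or> contains_K m t B"
      unfolding m_def ramsey_number_def by (rule LeastI_ex) (rule ramsey_number_exists)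
    moreover have "((R \<union> P) \<inter> complete_edges m) \<union> (B \<inter> complete_edges m) = complete_edges m"
        "((R \<union> P) \<inter> complete_edges m) \<inter> (B \<inter> complete_edges m) = {}"
      using c sub by (auto simp: rbp_colouring_def)
    ultimately have "contains_K m s ((R \<union> P) \<inter> complete_edges m) \<or>
        contains_K m t (B \<inter> complete_edges m)" by blast
    then show False
      using contains_K_restrict[OF m] R B' by blast
  qed
qed

end

theory Submission
  imports Defs
begin

text \<open>
  The inequality \<open>g \<le> RT\<close> is immediate, since \<open>R \<union> P\<close> is \<open>K\<^sub>s\<close>-free and has no independent set of
  size \<open>\<lceil>cn\<rceil>\<close>. Conversely it suffices to find a \<open>K\<^sub>s\<close>-free graph with almost \<open>RT\<close> edges and, inside
  it, a sparse subgraph \<open>R\<close> whose independence number is still below \<open>cn\<close>. Such an \<open>R\<close> exists in a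
  blow-up of a fixed graph \<open>G\<close> on \<open>m\<close> vertices: replace each complete bipartite graph between
  blown-up vertices by a sparse one without large empty rectangles. This makes the independence ratio
  only slightly worse than that of \<open>G\<close>. To have room for the loss, take for \<open>G\<close> an extremal graph for
  \<open>RT(s, cm, m)\<close>, with \<open>m\<close> chosen so that its edge density is close to the upper limit, and add a small
  disjoint triangle-free graph of independence ratio at most \<open>c/2\<close>. This brings the ratio strictly
  below \<open>c\<close> at a negligible cost in density. Graphs are handled with vertex weights of total one, so
  that blow-ups and disjoint unions need no divisibility conditions.
\<close>

section \<open>Weighted graphs\<close>

definition weighted_graph :: "'a set \<Rightarrow> ('a \<Rightarrow> real) \<Rightarrow> ('a \<Rightarrow> 'a \<Rightarrow> bool) \<Rightarrow> bool" where
  "weighted_graph X w E \<longleftrightarrow> finite X \<and> (\<forall>x\<in>X. 0 \<le> w x) \<and> sum w X = 1 \<and>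
     (\<forall>x y. E x y \<longrightarrow> E y x) \<and> (\<forall>x. \<not> E x x)"

definition indep_weight_le ::
  "'a set \<Rightarrow> ('a \<Rightarrow> real) \<Rightarrow> ('a \<Rightarrow> 'a \<Rightarrow> bool) \<Rightarrow> real \<Rightarrow> bool" where
  "indep_weight_le X w E a \<longleftrightarrow> (\<forall>I\<subseteq>X. (\<forall>x\<in>I. \<forall>y\<in>I. \<not> E x y) \<longrightarrow> sum w I \<le> a)"

definition K_free :: "nat \<Rightarrow> 'a set \<Rightarrow> ('a \<Rightarrow> 'a \<Rightarrow> bool) \<Rightarrow> bool" where
  "K_free s X E \<longleftrightarrow> (\<forall>S\<subseteq>X. card S = s \<longrightarrow> (\<exists>x\<in>S. \<exists>y\<in>S. x \<noteq> y \<and> \<not> E x y))"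

text \<open>The three vertices need not be distinct, so taking them equal excludes loops inside
  \<open>X\<close> as well; \<open>zykov_triangle_free\<close> relies on this.\<close>

definition triangle_free :: "'a set \<Rightarrow> ('a \<Rightarrow> 'a \<Rightarrow> bool) \<Rightarrow> bool" where
  "triangle_free X E \<longleftrightarrow> (\<forall>x\<in>X. \<forall>y\<in>X. \<forall>z\<in>X. \<not> (E x y \<and> E y z \<and> E x z))"

text \<open>Summed over ordered pairs, hence \<open>2 |E| / n\<^sup>2\<close> for uniform weights.\<close>

definition edge_weight :: "'a set \<Rightarrow> ('a \<Rightarrow> real) \<Rightarrow> ('a \<Rightarrow> 'a \<Rightarrow> bool) \<Rightarrow> real" where
  "edge_weight X w E = (\<Sum>x\<in>X. \<Sum>y\<in>X. if E x y then w x * w y else 0)"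

lemma triangle_free_imp_K_free:
  assumes "triangle_free X E" and "s \<ge> 3"
  shows "K_free s X E"
  unfolding K_free_def
proof (intro allI impI)
  fix S assume S: "S \<subseteq> X" "card S = s"
  then obtain T where T: "T \<subseteq> S" "card T = 3"
    using assms(2) by (metis obtain_subset_with_card_n)
  then obtain x y z where "T = {x, y, z}" "x \<noteq> y" "y \<noteq> z" "x \<noteq> z"
    by (auto simp: card_3_iff)
  moreover have "x \<in> X" "y \<in> X" "z \<in> X" using T S calculation by auto
  ultimately show "\<exists>x\<in>S. \<exists>y\<in>S. x \<noteq> y \<and> \<not> E x y"
    using assms(1) T unfolding triangle_free_def by (metis insertCI subsetD)
qed

text \<open>The vertices of positive weight carry total weight 1, more than \<open>a\<close>, so
  they are not independent, and an edge among them contributes a positive term. This later makes the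
  number of purple edges quadratic in \<open>n\<close>, so that additive errors o(n^2) become
  relative ones.\<close>

lemma edge_weight_pos:
  assumes "weighted_graph X w E" and "indep_weight_le X w E a" and "a < 1"
  shows "edge_weight X w E > 0"
proof -
  have fin: "finite X" and nn: "\<And>x. x \<in> X \<Longrightarrow> 0 \<le> w x" and one: "sum w X = 1"
    using assms(1) by (auto simp: weighted_graph_def)
  define I where "I = {x \<in> X. w x > 0}"
  have "sum w I = sum w X"
    using fin nn by (intro sum.mono_neutral_left) (auto simp: I_def less_le)
  then have "\<not> sum w I \<le> a" using one assms(3) by simp
  moreover have "I \<subseteq> X" by (auto simp: I_def)
  ultimately obtain x y where xy: "x \<in> I" "y \<in> I" "E x y"
    using assms(2) unfolding indep_weight_le_def by metis
  have "0 < w x * w y" using xy by (auto simp: I_def)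
  also have "\<dots> = (if E x y then w x * w y else 0)" using xy by simp
  also have "\<dots> \<le> (\<Sum>y\<in>X. if E x y then w x * w y else 0)"
    using xy nn fin by (intro member_le_sum) (auto simp: I_def)
  also have "\<dots> \<le> edge_weight X w E"
    unfolding edge_weight_def
    using xy nn fin by (intro member_le_sum[where f = "\<lambda>x. \<Sum>y\<in>X. if E x y then w x * w y else 0"])
      (auto simp: I_def intro!: sum_nonneg)
  finally show ?thesis .
qed

lemma subset_Plus_split:
  assumes "I \<subseteq> A <+> B"
  shows "I = (Inl -` I) <+> (Inr -` I)" "Inl -` I \<subseteq> A" "Inr -` I \<subseteq> B"
  using assms by (auto simp: Plus_def)

section \<open>Triangle-free graphs of small independence ratio\<close>

text \<open>A variant of Zykov's construction: \<open>N\<close> disjoint copies of a graph, of total weight \<open>1 - t\<close>,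
  and, for each choice \<open>f\<close> of one vertex in every copy, a new vertex joined to the chosen vertices.
  An independent set that has a positive proportion in the copies on average misses almost all new
  vertices. With \<open>t = 1 / (k + 1)\<close>, an independence ratio of about \<open>1 / k\<close> becomes about
  \<open>1 / (k + 1)\<close>.\<close>

fun zykov_adj :: "('a \<Rightarrow> 'a \<Rightarrow> bool) \<Rightarrow> nat \<times> 'a + (nat \<Rightarrow> 'a) \<Rightarrow> nat \<times> 'a + (nat \<Rightarrow> 'a) \<Rightarrow> bool"
where
  "zykov_adj E (Inl (i, x)) (Inl (j, y)) \<longleftrightarrow> i = j \<and> E x y"
| "zykov_adj E (Inl (i, x)) (Inr f) \<longleftrightarrow> f i = x"
| "zykov_adj E (Inr f) (Inl (i, x)) \<longleftrightarrow> f i = x"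
| "zykov_adj E (Inr f) (Inr h) \<longleftrightarrow> False"

definition zykov_vertices :: "nat \<Rightarrow> 'a set \<Rightarrow> (nat \<times> 'a + (nat \<Rightarrow> 'a)) set" where
  "zykov_vertices N X = ({..<N} \<times> X) <+> (\<Pi>\<^sub>E i\<in>{..<N}. X)"

text \<open>A new vertex \<open>f\<close> weighs as if its chosen vertices were drawn independently
  from \<open>w\<close>, one per copy. Sums over choice functions then factor into products over the
  copies.\<close>

fun zykov_weight :: "nat \<Rightarrow> real \<Rightarrow> ('a \<Rightarrow> real) \<Rightarrow> nat \<times> 'a + (nat \<Rightarrow> 'a) \<Rightarrow> real" where
  "zykov_weight N t w (Inl (i, x)) = (1 - t) / real N * w x"
| "zykov_weight N t w (Inr f) = t * (\<Prod>i<N. w (f i))"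

lemma zykov_weighted_graph:
  assumes "weighted_graph X w E" and "N > 0" and "0 \<le> t" "t \<le> 1"
  shows "weighted_graph (zykov_vertices N X) (zykov_weight N t w) (zykov_adj E)"
proof -
  have fin: "finite X" and nn: "\<And>x. x \<in> X \<Longrightarrow> 0 \<le> w x" and one: "sum w X = 1"
    and sym: "\<And>x y. E x y \<Longrightarrow> E y x" and irr: "\<And>x. \<not> E x x"
    using assms(1) by (auto simp: weighted_graph_def)
  have finP: "finite (\<Pi>\<^sub>E i\<in>{..<N}. X)" using fin by (intro finite_PiE) auto
  have "sum (zykov_weight N t w) (zykov_vertices N X) =
      (\<Sum>(i, x)\<in>{..<N} \<times> X. (1 - t) / real N * w x) + (\<Sum>f\<in>(\<Pi>\<^sub>E i\<in>{..<N}. X). t * (\<Prod>i<N. w (f i)))"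
    unfolding zykov_vertices_def using fin finP
    by (subst sum.Plus) (auto intro!: sum.cong)
  also have "(\<Sum>(i, x)\<in>{..<N} \<times> X. (1 - t) / real N * w x) = 1 - t"
    using assms(2) one by (simp add: sum.cartesian_product[symmetric] sum_distrib_left[symmetric]
        sum_divide_distrib[symmetric])
  also have "(\<Sum>f\<in>(\<Pi>\<^sub>E i\<in>{..<N}. X). t * (\<Prod>i<N. w (f i))) = t"
    using prod_sum_PiE[of "{..<N}" "\<lambda>_. X" "\<lambda>_. w"] fin one by (simp add: sum_distrib_left[symmetric])
  finally have 1: "sum (zykov_weight N t w) (zykov_vertices N X) = 1" by simp
  have 2: "0 \<le> zykov_weight N t w v" if "v \<in> zykov_vertices N X" for v
    using that nn assms(3,4)
    by (auto simp: zykov_vertices_def PiE_iff intro!: mult_nonneg_nonneg prod_nonneg)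
  have 3: "zykov_adj E u v \<Longrightarrow> zykov_adj E v u" for u v
    by (cases "(E, u, v)" rule: zykov_adj.cases) (auto intro: sym)
  have 4: "\<not> zykov_adj E u u" for u
    using irr by (cases u) auto
  show ?thesis
    unfolding weighted_graph_def using 1 2 3 4 fin finP by (auto simp: zykov_vertices_def)
qed

text \<open>A new vertex has only one neighbour in each copy, different copies are not joined, and
  new vertices are pairwise non-adjacent. Hence a triangle would have to lie inside one
  copy.\<close>

lemma zykov_triangle_free:
  assumes "triangle_free X E"
  shows "triangle_free (zykov_vertices N X) (zykov_adj E)"
proof -
  have tri: "\<not> (E x y \<and> E y z \<and> E x z)" if "x \<in> X" "y \<in> X" "z \<in> X" for x y z
    using assms that unfolding triangle_free_def by blast
  have irr: "\<not> E x x" if "x \<in> X" for x using tri[OF that that that] by simp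
  have "\<not> (zykov_adj E u v \<and> zykov_adj E v z \<and> zykov_adj E u z)"
    if "u \<in> zykov_vertices N X" "v \<in> zykov_vertices N X" "z \<in> zykov_vertices N X" for u v z
    using that unfolding zykov_vertices_def
    by (elim PlusE SigmaE) (use irr in \<open>auto dest: tri\<close>)
  then show ?thesis unfolding triangle_free_def by blast
qed

text \<open>The new vertices of an independent set choose in copy \<open>i\<close> a vertex outside
  the set, so their weight is at most \<open>t\<close> times the product of all
  \<open>1 - \<sigma> i\<close>. If the average of the \<open>\<sigma> i\<close> is at least \<eta>,
  that product is at most \<eta> and the copies give at most \<open>(1 - t) * a\<close>; otherwise
  the copies give at most \<eta> and the new vertices at most \<open>t\<close>. The two lower bounds
  on \<open>b\<close> belong to these two cases.\<close>

lemma zykov_indep_weight_le: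
  assumes "weighted_graph X w E" and "indep_weight_le X w E a" and "N > 0" and "0 \<le> t" "t \<le> 1"
    and "0 < \<eta>" and N: "real N \<ge> 1 / \<eta>\<^sup>2" and "(1 - t) * a + \<eta> \<le> b" and "\<eta> + t \<le> b"
  shows "indep_weight_le (zykov_vertices N X) (zykov_weight N t w) (zykov_adj E) b"
  unfolding indep_weight_le_def
proof (intro allI impI)
  have fin: "finite X" and nn: "\<And>x. x \<in> X \<Longrightarrow> 0 \<le> w x" and one: "sum w X = 1"
    using assms(1) by (auto simp: weighted_graph_def)
  have finP: "finite (\<Pi>\<^sub>E i\<in>{..<N}. X)" using fin by (intro finite_PiE) auto
  fix I assume I: "I \<subseteq> zykov_vertices N X" and ind: "\<forall>u\<in>I. \<forall>v\<in>I. \<not> zykov_adj E u v"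
  define A where "A i = {x. Inl (i, x) \<in> I}" for i
  define F where "F = Inr -` I"
  define \<sigma> where "\<sigma> i = sum w (A i)" for i
  have AX: "A i \<subseteq> X" for i using I by (auto simp: A_def zykov_vertices_def)
  have \<sigma>0: "0 \<le> \<sigma> i" for i unfolding \<sigma>_def using AX nn by (intro sum_nonneg) auto
  have \<sigma>1: "\<sigma> i \<le> 1" for i
    unfolding \<sigma>_def one[symmetric] using AX nn fin by (intro sum_mono2) auto
  have \<sigma>a: "\<sigma> i \<le> a" for i
  proof -
    have "\<not> E x y" if "x \<in> A i" "y \<in> A i" for x y
      using ind that by (force simp: A_def)
    then show ?thesis using assms(2) AX[of i] unfolding indep_weight_le_def \<sigma>_def by simp
  qed
  have Inl: "Inl -` I = Sigma {..<N} A"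
    using I by (auto simp: A_def zykov_vertices_def)
  have FP: "F \<subseteq> (\<Pi>\<^sub>E i\<in>{..<N}. X - A i)"
  proof
    fix f assume f: "f \<in> F"
    then have "f \<in> (\<Pi>\<^sub>E i\<in>{..<N}. X)" using I by (auto simp: F_def zykov_vertices_def)
    moreover have "f i \<notin> A i" for i
      using ind f by (force simp: F_def A_def)
    ultimately show "f \<in> (\<Pi>\<^sub>E i\<in>{..<N}. X - A i)" by (auto simp: PiE_iff)
  qed
  have "(\<Sum>f\<in>F. \<Prod>i<N. w (f i)) \<le> (\<Sum>f\<in>(\<Pi>\<^sub>E i\<in>{..<N}. X - A i). \<Prod>i<N. w (f i))"
    using FP fin nn by (intro sum_mono2 finite_PiE prod_nonneg) (auto simp: PiE_iff)
  also have "\<dots> = (\<Prod>i<N. sum w (X - A i))"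
    using prod_sum_PiE[of "{..<N}" "\<lambda>i. X - A i" "\<lambda>_. w"] fin by simp
  also have "\<dots> = (\<Prod>i<N. 1 - \<sigma> i)"
    using AX fin one by (intro prod.cong) (auto simp: sum_diff \<sigma>_def)
  finally have F: "(\<Sum>f\<in>F. \<Prod>i<N. w (f i)) \<le> (\<Prod>i<N. 1 - \<sigma> i)" .
  have "sum (zykov_weight N t w) I = (\<Sum>u\<in>(Inl -` I) <+> F. zykov_weight N t w u)"
    unfolding F_def using subset_Plus_split(1) I unfolding zykov_vertices_def by metis
  also have "\<dots> = (\<Sum>(i, x)\<in>Sigma {..<N} A. (1 - t) / real N * w x) + (\<Sum>f\<in>F. t * (\<Prod>i<N. w (f i)))"
    unfolding Inl using fin finP finite_subset[OF AX fin] finite_subset[OF FP]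
    by (subst sum.Plus) (auto intro!: sum.cong finite_PiE)
  also have "(\<Sum>(i, x)\<in>Sigma {..<N} A. (1 - t) / real N * w x) = (1 - t) / real N * (\<Sum>i<N. \<sigma> i)"
    using finite_subset[OF AX fin]
    by (simp add: sum.Sigma[symmetric] sum_distrib_left \<sigma>_def)
  also have "(\<Sum>f\<in>F. t * (\<Prod>i<N. w (f i))) = t * (\<Sum>f\<in>F. \<Prod>i<N. w (f i))"
    by (simp add: sum_distrib_left)
  also have "\<dots> \<le> t * (\<Prod>i<N. 1 - \<sigma> i)"
    using F assms(4) by (rule mult_left_mono)
  finally have le: "sum (zykov_weight N t w) I \<le>
      (1 - t) / real N * (\<Sum>i<N. \<sigma> i) + t * (\<Prod>i<N. 1 - \<sigma> i)" by simp
  have eq: "(1 - t) / real N * y = (1 - t) * (y / real N)" for y by simp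
  show "sum (zykov_weight N t w) I \<le> b"
  proof (cases "(\<Sum>i<N. \<sigma> i) \<ge> real N * \<eta>")
    case True
    have "(\<Prod>i<N. 1 - \<sigma> i) \<le> (\<Prod>i<N. exp (- \<sigma> i))"
      using \<sigma>1 exp_ge_add_one_self[of "- \<sigma> _"] by (intro prod_mono) auto
    also have "\<dots> = exp (- (\<Sum>i<N. \<sigma> i))" by (simp add: exp_sum sum_negf[symmetric])
    also have "\<dots> \<le> exp (- (real N * \<eta>))" using True by simp
    also have "\<dots> \<le> \<eta>"
    proof -
      \<comment> \<open>The quadratic bound on \<open>N\<close> makes the crude estimate
        \<open>exp y \<ge> y\<close> sufficient.\<close>
      have "1 / \<eta> \<le> real N * \<eta>" using N assms(6) by (simp add: field_simps power2_eq_square)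
      also have "\<dots> \<le> exp (real N * \<eta>)" using exp_ge_add_one_self[of "real N * \<eta>"] by linarith
      finally show ?thesis using assms(6) by (simp add: exp_minus field_simps)
    qed
    finally have "t * (\<Prod>i<N. 1 - \<sigma> i) \<le> 1 * \<eta>"
      using assms(4,5,6) \<sigma>1 by (intro mult_mono prod_nonneg) auto
    moreover have "(\<Sum>i<N. \<sigma> i) / real N \<le> a"
      using sum_bounded_above[of "{..<N}" \<sigma> a] \<sigma>a assms(3) by (simp add: field_simps)
    then have "(1 - t) / real N * (\<Sum>i<N. \<sigma> i) \<le> (1 - t) * a"
      unfolding eq using assms(5) by (intro mult_left_mono) auto
    ultimately show ?thesis using le assms(8) by simp
  next
    case False
    have "(\<Prod>i<N. 1 - \<sigma> i) \<le> 1" using \<sigma>0 \<sigma>1 by (intro prod_le_1) auto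
    then have "t * (\<Prod>i<N. 1 - \<sigma> i) \<le> t * 1" using assms(4) by (rule mult_left_mono)
    moreover have "(\<Sum>i<N. \<sigma> i) / real N \<le> \<eta>"
      using False assms(3) by (simp add: field_simps)
    then have "(1 - t) / real N * (\<Sum>i<N. \<sigma> i) \<le> 1 * \<eta>"
      unfolding eq using assms(4,5,6) \<sigma>0 by (intro mult_mono) (auto intro!: divide_nonneg_nonneg sum_nonneg)
    ultimately show ?thesis using le assms(9) by simp
  qed
qed

text \<open>The Zykov step changes the vertex type, so an induction that iterates it must return to
  a fixed type each time. An injection of the finite vertex set into the naturals transports the
  graph.\<close>

lemma weighted_graph_on_nat:
  fixes X :: "'a set"
  assumes "weighted_graph X w E" and "triangle_free X E" and "indep_weight_le X w E a"
  shows "\<exists>(Y :: nat set) v F. weighted_graph Y v F \<and> triangle_free Y F \<and> indep_weight_le Y v F a"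
proof -
  have fin: "finite X" using assms(1) by (simp add: weighted_graph_def)
  then obtain f :: "'a \<Rightarrow> nat" where inj: "inj_on f X"
    by (metis finite_imp_inj_to_nat_seg)
  define h where "h = inv_into X f"
  have hf: "h (f x) = x" if "x \<in> X" for x using inj that by (simp add: h_def)
  have injh: "inj_on h (f ` X)" by (auto simp: inj_on_def hf)
  have hX: "h ` f ` X = X" by (force simp: hf)
  have "weighted_graph (f ` X) (w \<circ> h) (\<lambda>i j. E (h i) (h j))"
    using assms(1) fin sum.reindex[OF injh, of w] unfolding hX by (simp add: weighted_graph_def hf)
  moreover have "triangle_free (f ` X) (\<lambda>i j. E (h i) (h j))"
    unfolding triangle_free_def
  proof (intro ballI)
    fix i j k assume "i \<in> f ` X" "j \<in> f ` X" "k \<in> f ` X"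
    then have "h i \<in> X" "h j \<in> X" "h k \<in> X" using hX by auto
    then show "\<not> (E (h i) (h j) \<and> E (h j) (h k) \<and> E (h i) (h k))"
      using assms(2) unfolding triangle_free_def by blast
  qed
  moreover have "indep_weight_le (f ` X) (w \<circ> h) (\<lambda>i j. E (h i) (h j)) a"
    unfolding indep_weight_le_def
  proof (intro allI impI)
    fix I assume I: "I \<subseteq> f ` X" "\<forall>i\<in>I. \<forall>j\<in>I. \<not> E (h i) (h j)"
    have "sum (w \<circ> h) I = sum w (h ` I)"
      using inj_on_subset[OF injh I(1)] by (simp add: sum.reindex)
    also have "\<dots> \<le> a"
    proof -
      have "h ` I \<subseteq> X" using I(1) hX by auto
      then show ?thesis using assms(3) I(2) unfolding indep_weight_le_def by simp
    qed
    finally show "sum (w \<circ> h) I \<le> a" .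
  qed
  ultimately show ?thesis by blast
qed

lemma triangle_free_indep_aux:
  assumes "b > 1 / real (Suc k)"
  shows "\<exists>(X :: nat set) w E. weighted_graph X w E \<and> triangle_free X E \<and> indep_weight_le X w E b"
  using assms
proof (induction k arbitrary: b)
  case 0
  have "indep_weight_le {0::nat} (\<lambda>_. 1) (\<lambda>_ _. False) b"
    using 0 by (auto simp: indep_weight_le_def subset_singleton_iff)
  moreover have "weighted_graph {0::nat} (\<lambda>_. 1) (\<lambda>_ _. False)"
    by (auto simp: weighted_graph_def)
  moreover have "triangle_free {0::nat} (\<lambda>_ _. False)"
    by (auto simp: triangle_free_def)
  ultimately show ?case by blast
next
  case (Suc k)
  \<comment> \<open>This \<open>t\<close> solves \<open>(1 - t) / (k + 1) = t\<close>, which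
    balances the two cases of \<open>zykov_indep_weight_le\<close>. The slack \<open>b - t\<close>
    is halved because \<eta> is spent twice, in the induction hypothesis and in the Zykov
    step.\<close>
  define t where "t = 1 / real (Suc (Suc k))"
  define \<eta> where "\<eta> = (b - t) / 2"
  have \<eta>: "\<eta> > 0" using Suc.prems by (simp add: \<eta>_def t_def)
  have "1 / real (Suc k) + \<eta> > 1 / real (Suc k)" using \<eta> by simp
  from Suc.IH[OF this] obtain X :: "nat set" and w E where
    X: "weighted_graph X w E" "triangle_free X E" "indep_weight_le X w E (1 / real (Suc k) + \<eta>)"
    by blast
  obtain N :: nat where N: "real N \<ge> 1 / \<eta>\<^sup>2" using real_arch_simple by blast
  have "0 < 1 / \<eta>\<^sup>2" using \<eta> by simp
  then have N0: "N > 0" using N by (metis not_gr_zero not_less of_nat_0)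
  have t: "0 \<le> t" "t \<le> 1" by (auto simp: t_def)
  have "(1 - t) * (1 / real (Suc k) + \<eta>) = t + (1 - t) * \<eta>"
  proof -
    have "1 - t = t * real (Suc k)" by (simp add: t_def field_simps)
    then have "(1 - t) * (1 / real (Suc k)) = t" by simp
    then show ?thesis by (simp only: distrib_left)
  qed
  also have "\<dots> \<le> t + 1 * \<eta>" using \<eta> t by (intro add_left_mono mult_right_mono) auto
  finally have 1: "(1 - t) * (1 / real (Suc k) + \<eta>) + \<eta> \<le> b" by (simp add: \<eta>_def field_simps)
  have 2: "\<eta> + t \<le> b" using \<eta> by (simp add: \<eta>_def field_simps)
  show ?case
    using weighted_graph_on_nat[OF zykov_weighted_graph[OF X(1) N0 t] zykov_triangle_free[OF X(2)]
        zykov_indep_weight_le[OF X(1) X(3) N0 t \<eta> N 1 2]] .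
qed

lemma triangle_free_small_independence:
  assumes "b > 0"
  shows "\<exists>(X :: nat set) w E. weighted_graph X w E \<and> triangle_free X E \<and> indep_weight_le X w E b"
proof -
  obtain k where "inverse (real (Suc k)) < b" using reals_Archimedean[OF assms] by blast
  then show ?thesis by (intro triangle_free_indep_aux[of k]) (simp add: inverse_eq_divide)
qed

section \<open>Sparse relations without large empty rectangles\<close>

lemma card_functions_constrained:
  assumes "K \<subseteq> {..<N}" and "Q \<subseteq> {..<q}"
  shows "card {u \<in> {..<N} \<rightarrow>\<^sub>E {..<q::nat}. \<forall>v\<in>K. u v \<in> Q} = card Q ^ card K * q ^ (N - card K)"
proof -
  have "{u \<in> {..<N} \<rightarrow>\<^sub>E {..<q}. \<forall>v\<in>K. u v \<in> Q} = (\<Pi>\<^sub>E i\<in>{..<N}. if i \<in> K then Q else {..<q})"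
    (is "?L = ?R")
  proof (intro set_eqI iffI)
    fix u assume "u \<in> ?R"
    moreover have "u v < q" if "v < N" for v
      using PiE_mem[OF \<open>u \<in> ?R\<close>, of v] that assms(2) by (auto split: if_splits)
    moreover have "u v \<in> Q" if "v \<in> K" for v
      using PiE_mem[OF \<open>u \<in> ?R\<close>, of v] that assms(1) by auto
    ultimately show "u \<in> ?L" by (simp add: PiE_iff)
  qed (auto simp: PiE_iff)
  then have "card {u \<in> {..<N} \<rightarrow>\<^sub>E {..<q}. \<forall>v\<in>K. u v \<in> Q} =
      (\<Prod>i<N. card (if i \<in> K then Q else {..<q}))"
    by (simp add: card_PiE)
  also have "\<dots> = (\<Prod>i<N. if i \<in> K then card Q else q)"
    by (intro prod.cong) auto
  also have "\<dots> = card Q ^ card ({..<N} \<inter> K) * q ^ card ({..<N} \<inter> - K)"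
    by (simp add: prod.If_cases)
  also have "{..<N} \<inter> K = K" using assms by auto
  also have "card ({..<N} \<inter> - K) = N - card K"
    using assms(1) card_Diff_subset[of K "{..<N}"] finite_subset[OF assms(1)] by (simp add: Diff_eq)
  finally show ?thesis .
qed

text \<open>An explicit substitute for a sparse random graph. Two vertices are related if the
  function of one vanishes at the point of the other, which has density at most
  \<open>2 / q\<close>. If \<open>A\<close> and \<open>B\<close> are unrelated, all functions in
  \<open>B\<close> avoid 0 on the set \<open>K\<close> of points of \<open>A\<close>, and only a
  proportion \<open>(1 - 1 / q) ^ card K\<close> of all functions does so. For fixed
  \<open>q\<close> this is below \<epsilon> once \<open>K\<close> is large.\<close>

lemma sparse_mixing_relation:
  fixes \<epsilon> :: real
  assumes "\<epsilon> > 0"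
  shows "\<exists>(Z :: (nat \<times> (nat \<Rightarrow> nat)) set) T. finite Z \<and> Z \<noteq> {} \<and> (\<forall>y z. T y z \<longrightarrow> T z y) \<and>
    real (card {(y, z) \<in> Z \<times> Z. T y z}) \<le> \<epsilon> * (real (card Z))\<^sup>2 \<and>
    (\<forall>A\<subseteq>Z. \<forall>B\<subseteq>Z. \<epsilon> * real (card Z) \<le> real (card A) \<longrightarrow> \<epsilon> * real (card Z) \<le> real (card B) \<longrightarrow>
      (\<exists>a\<in>A. \<exists>b\<in>B. T a b))"
proof -
  \<comment> \<open>Order of choice: \<open>q\<close> brings the density below \<epsilon>, then
    \<open>j\<close> brings \<open>r ^ j\<close> below \<epsilon>, then \<open>N\<close> ensures
    that any \<open>\<epsilon> * N\<close> points are at least \<open>j\<close> points.\<close>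
  obtain q0 :: nat where q0: "real q0 \<ge> 2 / \<epsilon>" using real_arch_simple by blast
  define q where "q = Suc q0"
  have q: "q > 0" "2 / real q \<le> \<epsilon>" using q0 assms by (auto simp: q_def field_simps)
  define r where "r = 1 - 1 / real q"
  have r: "0 \<le> r" "r < 1" using q by (auto simp: r_def)
  obtain j where j: "r ^ j < \<epsilon>" using real_arch_pow_inv[OF assms r(2)] by blast
  obtain N0 :: nat where N0: "real N0 \<ge> real j / \<epsilon>" using real_arch_simple by blast
  define N where "N = Suc N0"
  have N: "N > 0" "real j \<le> \<epsilon> * real N" using N0 assms by (auto simp: N_def field_simps)
  define U where "U = ({..<N} \<rightarrow>\<^sub>E {..<q})"
  define Z where "Z = {..<N} \<times> U"
  \<comment> \<open>For a fixed large set \<open>K \<subseteq> {..<N}\<close>, few functions avoid the value \<open>0\<close> on all of \<open>K\<close>; a vertex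
    carries both a point and a function in order to make \<open>T\<close> symmetric.\<close>
  define T where "T y z \<longleftrightarrow> snd z (fst y) = 0 \<or> snd y (fst z) = (0::nat)"
    for y z :: "nat \<times> (nat \<Rightarrow> nat)"
  have finU: "finite U" by (simp add: U_def finite_PiE)
  have cU: "card U = q ^ N" by (simp add: U_def card_PiE)
  have finZ: "finite Z" by (simp add: Z_def finU)
  have cZ: "card Z = N * q ^ N" by (simp add: Z_def card_cartesian_product cU)
  have Z0: "Z \<noteq> {}" using cZ N q by force
  have c0: "real (card {u \<in> U. u v = 0}) = real q ^ N / real q" if "v < N" for v
  proof -
    have "card {u \<in> U. u v = 0} = q ^ (N - 1)"
      using card_functions_constrained[of "{v}" N "{0}" q] that q by (simp add: U_def)
    moreover have "real q ^ N = real q ^ (N - 1) * real q" using N by (cases N) auto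
    ultimately show ?thesis using q by simp
  qed
  have sparse: "real (card {(y, z) \<in> Z \<times> Z. T y z}) \<le> \<epsilon> * (real (card Z))\<^sup>2"
  proof -
    \<comment> \<open>\<open>D\<close> holds the pairs related through the function of the second
      vertex. The other alternative in \<open>T\<close> is its mirror image, whence the factor 2
      below.\<close>
    define D where "D = Sigma Z (\<lambda>y. {..<N} \<times> {u \<in> U. u (fst y) = 0})"
    have finD: "finite D" by (simp add: D_def finZ finU)
    have "card D = (\<Sum>y\<in>Z. card ({..<N} \<times> {u \<in> U. u (fst y) = 0}))"
      unfolding D_def using finZ finU by (simp add: card_SigmaI)
    then have "real (card D) = (\<Sum>y\<in>Z. real N * (real q ^ N / real q))"
      by (simp only: of_nat_sum) (intro sum.cong, auto simp: card_cartesian_product c0 Z_def)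
    then have D: "real (card D) = (real (card Z))\<^sup>2 / real q"
      by (simp add: cZ power2_eq_square)
    have "{(y, z) \<in> Z \<times> Z. T y z} \<subseteq> D \<union> prod.swap ` D"
      by (auto simp: D_def T_def Z_def image_iff)
    then have "card {(y, z) \<in> Z \<times> Z. T y z} \<le> card (D \<union> prod.swap ` D)"
      using finD by (intro card_mono) auto
    also have "\<dots> \<le> card D + card (prod.swap ` D)" by (rule card_Un_le)
    also have "\<dots> \<le> 2 * card D" using card_image_le[OF finD, of prod.swap] by simp
    finally have "real (card {(y, z) \<in> Z \<times> Z. T y z}) \<le> 2 / real q * (real (card Z))\<^sup>2"
      using D by simp
    also have "\<dots> \<le> \<epsilon> * (real (card Z))\<^sup>2" using q by (intro mult_right_mono) auto
    finally show ?thesis .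
  qed
  have mixing: "\<exists>a\<in>A. \<exists>b\<in>B. T a b"
    if AB: "A \<subseteq> Z" "B \<subseteq> Z" "\<epsilon> * real (card Z) \<le> real (card A)" "\<epsilon> * real (card Z) \<le> real (card B)"
    for A B
  proof (rule ccontr)
    assume no: "\<not> (\<exists>a\<in>A. \<exists>b\<in>B. T a b)"
    define K where "K = fst ` A"
    have K: "K \<subseteq> {..<N}" using AB(1) by (auto simp: K_def Z_def)
    have finK: "finite K" using K finite_subset by blast
    \<comment> \<open>At most \<open>q ^ N\<close> elements of \<open>A\<close> share a point, so a
      large \<open>A\<close> has many points.\<close>
    have "A \<subseteq> K \<times> U" using AB(1) by (force simp: K_def Z_def)
    then have "card A \<le> card K * q ^ N"
      using card_mono[of "K \<times> U" A] finK finU by (simp add: card_cartesian_product cU)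
    then have "\<epsilon> * (real N * real q ^ N) \<le> real (card K) * real q ^ N"
      using AB(3) unfolding cZ by (metis (mono_tags) of_nat_le_iff of_nat_mult of_nat_power order_trans)
    then have "(\<epsilon> * real N) * real q ^ N \<le> real (card K) * real q ^ N" by (simp add: mult.assoc)
    then have "\<epsilon> * real N \<le> real (card K)" using q by simp
    then have jK: "j \<le> card K" using N(2) by simp
    define W where "W = {u \<in> U. \<forall>v\<in>K. u v \<in> {1..<q}}"
    have "B \<subseteq> {..<N} \<times> W"
    proof
      fix b assume b: "b \<in> B"
      then obtain v u where vu: "b = (v, u)" "v < N" "u \<in> U" using AB(2) by (auto simp: Z_def)
      have "u x \<in> {1..<q}" if x: "x \<in> K" for x
      proof -
        obtain a where "a \<in> A" "fst a = x" using x by (auto simp: K_def)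
        then have "u x \<noteq> 0" using no b vu(1) by (force simp: T_def)
        moreover have "u x < q" using vu(3) x K by (auto simp: U_def PiE_iff)
        ultimately show ?thesis by simp
      qed
      then show "b \<in> {..<N} \<times> W" using vu by (simp add: W_def)
    qed
    then have "card B \<le> N * card W"
      using card_mono[of "{..<N} \<times> W" B] finU by (simp add: card_cartesian_product W_def)
    then have "\<epsilon> * (real N * real q ^ N) \<le> real N * real (card W)"
      using AB(4) unfolding cZ by (metis (mono_tags) of_nat_le_iff of_nat_mult of_nat_power order_trans)
    then have "real N * (\<epsilon> * real q ^ N) \<le> real N * real (card W)" by (simp add: mult.left_commute)
    then have "\<epsilon> * real q ^ N \<le> real (card W)" using N(1) by simp
    also have "card W = (q - 1) ^ card K * q ^ (N - card K)"
      unfolding W_def U_def by (subst card_functions_constrained[OF K]) auto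
    also have "real \<dots> = (real q - 1) ^ card K * real q ^ (N - card K)"
      using q by (simp add: of_nat_diff)
    also have "real q - 1 = r * real q" using q by (simp add: r_def field_simps)
    also have "(r * real q) ^ card K * real q ^ (N - card K) = r ^ card K * real q ^ N"
    proof -
      have "card K \<le> N" using card_mono[OF _ K] by simp
      then show ?thesis by (simp add: power_mult_distrib flip: power_add)
    qed
    finally have "\<epsilon> \<le> r ^ card K" using q by simp
    also have "\<dots> \<le> r ^ j" using r jK by (intro power_decreasing) auto
    finally show False using j by simp
  qed
  show ?thesis
    using finZ Z0 sparse mixing by (intro exI[of _ Z] exI[of _ T]) (auto simp: T_def)
qed

section \<open>Blow-ups\<close>

lemma map_with_fibre_sizes:
  assumes "finite X" and "sum k X = n"
  shows "\<exists>\<phi> :: nat \<Rightarrow> 'a. (\<forall>i<n. \<phi> i \<in> X) \<and> (\<forall>x\<in>X. card {i. i < n \<and> \<phi> i = x} = k x)"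
proof -
  let ?S = "Sigma X (\<lambda>x. {..<k x})"
  have "card ?S = n" using assms by (simp add: card_SigmaI)
  moreover have "finite ?S" using assms(1) by simp
  ultimately obtain h where h: "bij_betw h {..<n} ?S"
    using finite_same_card_bij[of "{..<n}" ?S] by auto
  have "fst (h i) \<in> X" if "i < n" for i
    using bij_betw_apply[OF h, of i] that by auto
  moreover have "card {i. i < n \<and> fst (h i) = x} = k x" if x: "x \<in> X" for x
  proof -
    have "h ` {i. i < n \<and> fst (h i) = x} = {p \<in> h ` {..<n}. fst p = x}" by auto
    also have "\<dots> = {x} \<times> {..<k x}" using bij_betw_imp_surj_on[OF h] x by auto
    finally have "card (h ` {i. i < n \<and> fst (h i) = x}) = k x" by (simp add: card_cartesian_product)
    moreover have "inj_on h {i. i < n \<and> fst (h i) = x}"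
      using bij_betw_imp_inj_on[OF h] by (rule inj_on_subset) auto
    ultimately show ?thesis by (simp add: card_image)
  qed
  ultimately show ?thesis by (intro exI[of _ "\<lambda>i. fst (h i)"]) auto
qed

text \<open>Rounding every \<open>w x * n\<close> down leaves a total remainder of o(n), because the
  rounded proportions add up to something that tends to 1. The whole remainder can go to a single
  vertex \<open>x0\<close> without changing any limit.\<close>

lemma map_with_fibre_proportions:
  fixes w :: "'a \<Rightarrow> real"
  assumes fin: "finite X" and nn: "\<forall>x\<in>X. 0 \<le> w x" and one: "sum w X = 1"
  shows "\<exists>\<phi> :: nat \<Rightarrow> nat \<Rightarrow> 'a. (\<forall>n. \<forall>i<n. \<phi> n i \<in> X) \<and>
    (\<forall>x\<in>X. (\<lambda>n. real (card {i. i < n \<and> \<phi> n i = x}) / real n) \<longlonglongrightarrow> w x)"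
proof -
  obtain x0 where x0: "x0 \<in> X" using one by fastforce
  define b where "b n x = nat \<lfloor>w x * real n\<rfloor>" for n x
  define k where "k n x = b n x + (if x = x0 then n - sum (b n) X else 0)" for n x
  have b: "w x * real n - 1 \<le> real (b n x)" "real (b n x) \<le> w x * real n" if "x \<in> X" for n x
  proof -
    have "0 \<le> w x * real n" using nn that by simp
    then have "real (b n x) = of_int \<lfloor>w x * real n\<rfloor>" by (simp add: b_def)
    then show "w x * real n - 1 \<le> real (b n x)" "real (b n x) \<le> w x * real n" by linarith+
  qed
  have sb: "sum (b n) X \<le> n" for n
  proof -
    have "real (sum (b n) X) \<le> (\<Sum>x\<in>X. w x * real n)"
      using b(2) by (simp add: sum_mono)
    also have "\<dots> = real n" using one by (simp add: sum_distrib_right[symmetric])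
    finally show ?thesis by (simp only: of_nat_le_iff)
  qed
  have "sum (k n) X = n" for n
    using sb[of n] fin x0 by (simp add: k_def sum.distrib)
  then have "\<forall>n. \<exists>\<phi> :: nat \<Rightarrow> 'a. (\<forall>i<n. \<phi> i \<in> X) \<and> (\<forall>x\<in>X. card {i. i < n \<and> \<phi> i = x} = k n x)"
    using map_with_fibre_sizes[OF fin] by blast
  then obtain \<phi> :: "nat \<Rightarrow> nat \<Rightarrow> 'a" where
    \<phi>: "\<And>n. (\<forall>i<n. \<phi> n i \<in> X) \<and> (\<forall>x\<in>X. card {i. i < n \<and> \<phi> n i = x} = k n x)"
    by metis
  have bl: "(\<lambda>n. real (b n x) / real n) \<longlonglongrightarrow> w x" if x: "x \<in> X" for x
  proof (rule tendsto_sandwich)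
    show "(\<lambda>n. w x - 1 / real n) \<longlonglongrightarrow> w x"
      using tendsto_diff[OF tendsto_const[of "w x"] lim_1_over_n[where 'a = real]] by simp
    show "(\<lambda>n. w x) \<longlonglongrightarrow> w x" by simp
    show "\<forall>\<^sub>F n in sequentially. w x - 1 / real n \<le> real (b n x) / real n"
      using eventually_gt_at_top[of 0]
    proof eventually_elim
      case (elim n) then show ?case using b(1)[OF x, of n] divide_right_mono[of "w x * real n - 1" "real (b n x)" "real n"]
        by (simp add: diff_divide_distrib)
    qed
    show "\<forall>\<^sub>F n in sequentially. real (b n x) / real n \<le> w x"
      using eventually_gt_at_top[of 0]
    proof eventually_elim
      case (elim n) then show ?case using b(2)[OF x, of n] by (simp add: field_simps)
    qed
  qed
  have "(\<lambda>n. 1 - (\<Sum>x\<in>X. real (b n x) / real n)) \<longlonglongrightarrow> 1 - sum w X"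
    by (intro tendsto_intros bl)
  then have "(\<lambda>n. 1 - (\<Sum>x\<in>X. real (b n x) / real n)) \<longlonglongrightarrow> 0" using one by simp
  moreover have "\<forall>\<^sub>F n in sequentially.
      1 - (\<Sum>x\<in>X. real (b n x) / real n) = real (n - sum (b n) X) / real n"
    using eventually_gt_at_top[of 0]
  proof eventually_elim
    case (elim n)
    then show ?case using sb[of n]
      by (simp add: of_nat_diff diff_divide_distrib sum_divide_distrib)
  qed
  ultimately have rest: "(\<lambda>n. real (n - sum (b n) X) / real n) \<longlonglongrightarrow> 0"
    by (rule Lim_transform_eventually)
  have "(\<lambda>n. real (k n x) / real n) \<longlonglongrightarrow> w x" if x: "x \<in> X" for x
  proof (cases "x = x0")
    case True
    then show ?thesis using tendsto_add[OF bl[OF x] rest]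
      by (simp add: k_def add_divide_distrib)
  qed (use bl[OF x] in \<open>simp add: k_def\<close>)
  then show ?thesis using \<phi> by (intro exI[of _ \<phi>]) simp
qed

lemma sum_over_fibres:
  fixes h :: "'a \<Rightarrow> real" and n :: nat
  assumes "finite X" and "\<And>i. i < n \<Longrightarrow> \<phi> i \<in> X"
  shows "(\<Sum>i<n. h (\<phi> i)) = (\<Sum>x\<in>X. real (card {i. i < n \<and> \<phi> i = x}) * h x)"
proof -
  have "(\<Sum>i<n. h (\<phi> i)) = (\<Sum>x\<in>X. \<Sum>i\<in>{i \<in> {..<n}. \<phi> i = x}. h (\<phi> i))"
    using assms by (intro sum.group[symmetric]) auto
  also have "\<dots> = (\<Sum>x\<in>X. real (card {i. i < n \<and> \<phi> i = x}) * h x)"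
    by (intro sum.cong) (auto simp: lessThan_def)
  finally show ?thesis .
qed

section \<open>Blow-ups as graphs on n vertices and their edge counts\<close>

lemma card_ordered_edges:
  assumes "E \<subseteq> complete_edges n"
  shows "card {(i, j). {i, j} \<in> E} = 2 * card E"
proof -
  have fin: "finite E" using assms finite_complete_edges finite_subset by blast
  have "{(i, j). {i, j} \<in> E} = (\<Union>e\<in>E. {(i, j). {i, j} = e})" by auto
  moreover have card2: "card {(i, j). {i, j} = e} = 2 \<and> finite {(i, j). {i, j} = e}" if "e \<in> E" for e
  proof -
    have "e \<in> [{..<n}]\<^bsup>2\<^esup>" using that assms by (auto simp: complete_edges_def)
    then obtain u v where uv: "e = {u, v}" "u \<noteq> v" by (auto simp: nsets_2_eq)
    then have "{(i, j). {i, j} = e} = {(u, v), (v, u)}" by (auto simp: doubleton_eq_iff)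
    then show ?thesis using uv by simp
  qed
  moreover have "card (\<Union>e\<in>E. {(i, j). {i, j} = e}) = (\<Sum>e\<in>E. card {(i, j). {i, j} = e})"
    using fin card2 by (intro card_UN_disjoint) auto
  ultimately show ?thesis by simp
qed

text \<open>The blow-up of \<open>E\<close> in which the vertex \<open>x\<close> is replaced by the
  class of all \<open>i < n\<close> with \<open>\<phi> i = x\<close>.\<close>

definition pullback_edges :: "nat \<Rightarrow> (nat \<Rightarrow> 'a) \<Rightarrow> ('a \<Rightarrow> 'a \<Rightarrow> bool) \<Rightarrow> nat set set" where
  "pullback_edges n \<phi> E = {{i, j} | i j. i < n \<and> j < n \<and> E (\<phi> i) (\<phi> j)}"

lemma doubleton_in_pullback_edges:
  assumes "\<And>x y. E x y \<Longrightarrow> E y x"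
  shows "{i, j} \<in> pullback_edges n \<phi> E \<longleftrightarrow> i < n \<and> j < n \<and> E (\<phi> i) (\<phi> j)"
  using assms by (auto simp: pullback_edges_def doubleton_eq_iff)

lemma pullback_edges_subset:
  assumes "\<And>x. \<not> E x x"
  shows "pullback_edges n \<phi> E \<subseteq> complete_edges n"
  using assms by (auto simp: pullback_edges_def complete_edges_def)

text \<open>Ordered adjacent pairs are grouped by the classes of their two ends. The class sizes act
  as weights that are not normalised; dividing by n^2 comes later.\<close>

lemma card_pullback_edges:
  assumes "finite X" and \<phi>: "\<And>i. i < n \<Longrightarrow> \<phi> i \<in> X"
    and sym: "\<And>x y. E x y \<Longrightarrow> E y x" and irr: "\<And>x. \<not> E x x"
  shows "2 * real (card (pullback_edges n \<phi> E)) =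
    edge_weight X (\<lambda>x. real (card {i. i < n \<and> \<phi> i = x})) E"
proof -
  let ?f = "\<lambda>x. real (card {i. i < n \<and> \<phi> i = x})"
  let ?O = "{(i, j). {i, j} \<in> pullback_edges n \<phi> E}"
  have O: "?O = Sigma {..<n} (\<lambda>i. {j \<in> {..<n}. E (\<phi> i) (\<phi> j)})"
    using doubleton_in_pullback_edges[of E _ _ n \<phi>, OF sym] by auto
  have "2 * real (card (pullback_edges n \<phi> E)) = real (card ?O)"
    using card_ordered_edges[OF pullback_edges_subset[of E n \<phi>, OF irr]] by simp
  also have "\<dots> = (\<Sum>i<n. real (card {j \<in> {..<n}. E (\<phi> i) (\<phi> j)}))"
    unfolding O by (simp add: card_SigmaI)
  also have "\<dots> = (\<Sum>i<n. \<Sum>j<n. if E (\<phi> i) (\<phi> j) then 1 else 0)"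
    by (simp add: sum.If_cases Int_def)
  also have "\<dots> = (\<Sum>i<n. \<Sum>y\<in>X. ?f y * (if E (\<phi> i) y then 1 else 0))"
    using sum_over_fibres[OF assms(1), of n \<phi>, OF \<phi>, where h = "\<lambda>y. if E _ y then 1 else 0"] by simp
  also have "\<dots> = (\<Sum>x\<in>X. ?f x * (\<Sum>y\<in>X. ?f y * (if E x y then 1 else 0)))"
    using sum_over_fibres[OF assms(1), of n \<phi>, OF \<phi>,
        where h = "\<lambda>x. \<Sum>y\<in>X. ?f y * (if E x y then 1 else 0)"] by simp
  also have "\<dots> = edge_weight X ?f E"
    unfolding edge_weight_def by (auto simp: sum_distrib_left intro!: sum.cong)
  finally show ?thesis .
qed

section \<open>Sparse subgraphs of blow-ups\<close>

lemma edge_weight_nonneg: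
  assumes "\<And>x. x \<in> X \<Longrightarrow> 0 \<le> w x"
  shows "0 \<le> edge_weight X w E"
  unfolding edge_weight_def using assms by (auto intro!: sum_nonneg)

lemma edge_weight_le_1:
  assumes "weighted_graph X w E"
  shows "edge_weight X w E \<le> 1"
proof -
  have nn: "\<And>x. x \<in> X \<Longrightarrow> 0 \<le> w x" and one: "sum w X = 1"
    using assms by (auto simp: weighted_graph_def)
  have "edge_weight X w E \<le> (\<Sum>x\<in>X. \<Sum>y\<in>X. w x * w y)"
    unfolding edge_weight_def using nn by (intro sum_mono) auto
  also have "\<dots> = 1" using one by (simp add: sum_distrib_left[symmetric] sum_distrib_right[symmetric])
  finally show ?thesis .
qed

text \<open>On \<open>X \<times> Z\<close>, \<open>R\<close> keeps from each complete bipartite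
  graph only the pairs related by the sparse mixing relation. For an \<open>R\<close>-independent
  set, the vertices of \<open>X\<close> with a large fibre are independent in \<open>E\<close>,
  since two large fibres over adjacent vertices would be joined. The small fibres add at most
  \<epsilon>. Removing \<open>R\<close> costs at most \<epsilon> in density.\<close>

lemma sparse_subgraph_of_blowup:
  fixes X :: "'a set"
  assumes wg: "weighted_graph X w E" and ind: "indep_weight_le X w E a" and \<epsilon>: "\<epsilon> > 0"
  shows "\<exists>(Y :: ('a \<times> nat \<times> (nat \<Rightarrow> nat)) set) v R. weighted_graph Y v R \<and> fst ` Y \<subseteq> X \<and>
    (\<forall>y z. R y z \<longrightarrow> E (fst y) (fst z)) \<and> indep_weight_le Y v R (a + \<epsilon>) \<and>
    edge_weight X w E - \<epsilon> \<le> edge_weight Y v (\<lambda>y z. E (fst y) (fst z) \<and> \<not> R y z)"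
proof -
  have fin: "finite X" and nn: "\<And>x. x \<in> X \<Longrightarrow> 0 \<le> w x" and one: "sum w X = 1"
    and sym: "\<And>x y. E x y \<Longrightarrow> E y x" and irr: "\<And>x. \<not> E x x"
    using wg by (auto simp: weighted_graph_def)
  obtain Z :: "(nat \<times> (nat \<Rightarrow> nat)) set" and T where Z: "finite Z" "Z \<noteq> {}"
    and T': "\<forall>y z. T y z \<longrightarrow> T z y"
    and sparse: "real (card {(y, z) \<in> Z \<times> Z. T y z}) \<le> \<epsilon> * (real (card Z))\<^sup>2"
    and mix': "\<forall>A\<subseteq>Z. \<forall>B\<subseteq>Z. \<epsilon> * real (card Z) \<le> real (card A) \<longrightarrow>
        \<epsilon> * real (card Z) \<le> real (card B) \<longrightarrow> (\<exists>a\<in>A. \<exists>b\<in>B. T a b)"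
    using sparse_mixing_relation[OF \<epsilon>] by (elim exE conjE) (rule that)
  have T: "T y z \<Longrightarrow> T z y" for y z using T' by blast
  have mix: "\<exists>a\<in>A. \<exists>b\<in>B. T a b" if "A \<subseteq> Z" "B \<subseteq> Z" "\<epsilon> * real (card Z) \<le> real (card A)"
      "\<epsilon> * real (card Z) \<le> real (card B)" for A B
    using mix' that by simp
  define M where "M = real (card Z)"
  have M: "M > 0" using Z by (auto simp: M_def card_gt_0_iff)
  define Y where "Y = X \<times> Z"
  define v where "v y = w (fst y) / M" for y :: "'a \<times> nat \<times> (nat \<Rightarrow> nat)"
  define R where "R y z \<longleftrightarrow> E (fst y) (fst z) \<and> T (snd y) (snd z)"
    for y z :: "'a \<times> nat \<times> (nat \<Rightarrow> nat)"
  have "sum v Y = (\<Sum>x\<in>X. \<Sum>z\<in>Z. w x / M)"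
    by (simp add: Y_def v_def sum.cartesian_product case_prod_beta del: sum_constant)
  also have "\<dots> = 1" using M one by (simp add: M_def)
  finally have 1: "weighted_graph Y v R"
    unfolding weighted_graph_def using fin Z nn sym irr T M by (auto simp: Y_def v_def R_def)
  have 2: "indep_weight_le Y v R (a + \<epsilon>)"
    unfolding indep_weight_le_def
  proof (intro allI impI)
    fix J assume J: "J \<subseteq> Y" and Jind: "\<forall>y\<in>J. \<forall>z\<in>J. \<not> R y z"
    define A where "A x = {z. (x, z) \<in> J}" for x
    have AZ: "A x \<subseteq> Z" for x using J by (auto simp: A_def Y_def)
    have finA: "finite (A x)" for x using finite_subset[OF AZ Z(1)] .
    have JA: "J = Sigma X A" using J by (auto simp: A_def Y_def)
    define L where "L = {x \<in> X. \<epsilon> * M \<le> real (card (A x))}"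
    have "\<not> E x x'" if "x \<in> L" "x' \<in> L" for x x'
    proof
      assume E: "E x x'"
      obtain p q where "p \<in> A x" "q \<in> A x'" "T p q"
        using mix[OF AZ[of x] AZ[of x']] \<open>x \<in> L\<close> \<open>x' \<in> L\<close> by (auto simp: L_def M_def)
      then have "(x, p) \<in> J" "(x', q) \<in> J" "R (x, p) (x', q)" using E by (auto simp: A_def R_def)
      then show False using Jind by blast
    qed
    moreover have "L \<subseteq> X" by (auto simp: L_def)
    ultimately have La: "sum w L \<le> a" using ind unfolding indep_weight_le_def by metis
    have "sum v J = (\<Sum>x\<in>X. \<Sum>z\<in>A x. w x / M)"
      unfolding JA v_def using fin finA by (simp add: sum.Sigma case_prod_beta del: sum_constant)
    also have "\<dots> = (\<Sum>x\<in>X. w x * (real (card (A x)) / M))" by (simp add: mult.commute)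
    \<comment> \<open>A fibre fills a proportion of at most 1 over \<open>L\<close> and at most
      \<epsilon> elsewhere. Allowing \<open>1 + \<epsilon>\<close> over \<open>L\<close> makes the
      total simply \<open>sum w L + \<epsilon>\<close>.\<close>
    also have "\<dots> \<le> (\<Sum>x\<in>X. w x * ((if x \<in> L then 1 else 0) + \<epsilon>))"
    proof (intro sum_mono mult_left_mono nn)
      fix x assume x: "x \<in> X"
      show "real (card (A x)) / M \<le> (if x \<in> L then 1 else 0) + \<epsilon>"
      proof (cases "x \<in> L")
        case True
        have "real (card (A x)) \<le> M" using card_mono[OF Z(1) AZ[of x]] by (simp add: M_def)
        then have "real (card (A x)) / M \<le> 1" using M by simp
        then show ?thesis using True \<epsilon> by simp
      next
        case False
        then have "real (card (A x)) \<le> \<epsilon> * M" using x by (simp add: L_def)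
        then show ?thesis using False M by (simp add: field_simps)
      qed
    qed
    also have "\<dots> = (\<Sum>x\<in>X. w x * (if x \<in> L then 1 else 0)) + (\<Sum>x\<in>X. w x * \<epsilon>)"
      by (simp add: distrib_left sum.distrib)
    also have "(\<Sum>x\<in>X. w x * \<epsilon>) = \<epsilon>" using one by (simp add: sum_distrib_right[symmetric])
    also have "(\<Sum>x\<in>X. w x * (if x \<in> L then 1 else 0)) = sum w L"
      using fin by (intro sum.mono_neutral_cong_right) (auto simp: L_def)
    finally show "sum v J \<le> a + \<epsilon>" using La by simp
  qed
  define F where "F y z \<longleftrightarrow> E (fst y) (fst z) \<and> \<not> R y z" for y z
  \<comment> \<open>The density of unrelated pairs. Adjacency depends on the first coordinates and
    \<open>T\<close> on the second ones, so the edge weight of \<open>F\<close> factors as that of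
    \<open>E\<close> times \<tau>.\<close>
  define \<tau> where "\<tau> = (\<Sum>p\<in>Z. \<Sum>q\<in>Z. if T p q then 0 else 1 / M\<^sup>2)"
  have 3: "edge_weight X w E - \<epsilon> \<le> edge_weight Y v F"
  proof -
    have "(\<Sum>p\<in>Z. \<Sum>q\<in>Z. if T p q then 1 / M\<^sup>2 else 0) = real (card {(y, z) \<in> Z \<times> Z. T y z}) / M\<^sup>2"
    proof -
      have "{(y, z) \<in> Z \<times> Z. T y z} = Sigma Z (\<lambda>y. {z \<in> Z. T y z})" by auto
      then show ?thesis using Z
        by (simp add: card_SigmaI sum.If_cases Int_def sum_divide_distrib)
    qed
    also have "\<dots> \<le> \<epsilon>"
      using sparse M unfolding M_def by (subst pos_divide_le_eq) auto
    finally have "(\<Sum>p\<in>Z. \<Sum>q\<in>Z. if T p q then 1 / M\<^sup>2 else 0) \<le> \<epsilon>" .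
    moreover have "\<tau> + (\<Sum>p\<in>Z. \<Sum>q\<in>Z. if T p q then 1 / M\<^sup>2 else 0) = (\<Sum>p\<in>Z. \<Sum>q\<in>Z. 1 / M\<^sup>2)"
      unfolding \<tau>_def by (simp only: sum.distrib[symmetric]) (intro sum.cong, auto)
    moreover have "(\<Sum>p\<in>Z. \<Sum>q\<in>Z. 1 / M\<^sup>2) = 1"
      using M by (simp add: M_def power2_eq_square)
    ultimately have \<tau>: "1 - \<epsilon> \<le> \<tau>" by linarith
    have "edge_weight Y v F = (\<Sum>x\<in>X. \<Sum>p\<in>Z. \<Sum>x'\<in>X. \<Sum>q\<in>Z.
        (if E x x' then w x * w x' else 0) * (if T p q then 0 else 1 / M\<^sup>2))"
      unfolding edge_weight_def Y_def
      by (simp only: sum.cartesian_product')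
        (intro sum.cong refl, auto simp: v_def F_def R_def power2_eq_square)
    also have "\<dots> = (\<Sum>x\<in>X. \<Sum>x'\<in>X. \<Sum>p\<in>Z. \<Sum>q\<in>Z.
        (if E x x' then w x * w x' else 0) * (if T p q then 0 else 1 / M\<^sup>2))"
      by (intro sum.cong refl sum.swap)
    also have "\<dots> = edge_weight X w E * \<tau>"
      unfolding edge_weight_def sum_distrib_right unfolding \<tau>_def sum_distrib_left ..
    finally have eq: "edge_weight Y v F = edge_weight X w E * \<tau>" .
    have ew: "0 \<le> edge_weight X w E" "edge_weight X w E \<le> 1"
      using edge_weight_nonneg nn edge_weight_le_1[OF wg] by auto
    have "edge_weight X w E - \<epsilon> \<le> edge_weight X w E * (1 - \<epsilon>)"
      using ew \<epsilon> mult_right_mono[of "edge_weight X w E" 1 \<epsilon>] by (simp add: algebra_simps)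
    also have "\<dots> \<le> edge_weight X w E * \<tau>" using \<tau> ew by (intro mult_left_mono)
    finally show ?thesis using eq by simp
  qed
  have "fst ` Y \<subseteq> X" by (auto simp: Y_def)
  then show ?thesis
    using 1 2 3 unfolding F_def by (intro exI[of _ Y] exI[of _ v] exI[of _ R]) (auto simp: R_def)
qed

section \<open>Colourings from weighted graphs\<close>

lemma not_contains_K_pullback:
  assumes "K_free s X E" and "\<And>i. i < n \<Longrightarrow> \<phi> i \<in> X"
    and sym: "\<And>x y. E x y \<Longrightarrow> E y x" and irr: "\<And>x. \<not> E x x"
  shows "\<not> contains_K n s (pullback_edges n \<phi> E)"
proof
  assume "contains_K n s (pullback_edges n \<phi> E)"
  then obtain S where S: "S \<subseteq> {..<n}" "card S = s" "clique S (pullback_edges n \<phi> E)"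
    unfolding contains_K_def by blast
  have adj: "E (\<phi> i) (\<phi> j)" if "i \<in> S" "j \<in> S" "i \<noteq> j" for i j
    using S(3) that doubleton_in_pullback_edges[of E i j n \<phi>, OF sym] unfolding clique_def by blast
  \<comment> \<open>No edges run inside a class, because \<open>E\<close> has no loops. So a clique
    meets each class at most once and its image is a clique of the same size.\<close>
  have inj: "inj_on \<phi> S"
  proof (rule inj_onI, rule ccontr)
    fix i j assume "i \<in> S" "j \<in> S" "\<phi> i = \<phi> j" "i \<noteq> j"
    then show False using adj[of i j] irr by simp
  qed
  have "\<phi> ` S \<subseteq> X" "card (\<phi> ` S) = s" using S assms(2) inj by (auto simp: card_image)
  then obtain x y where "x \<in> \<phi> ` S" "y \<in> \<phi> ` S" "x \<noteq> y" "\<not> E x y"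
    using assms(1) unfolding K_free_def by blast
  then show False using adj by blast
qed

text \<open>The colouring is a blow-up of the one given by \<open>sparse_subgraph_of_blowup\<close>:
  \<open>R\<close> becomes red, the remaining edges over \<open>E\<close> purple, all other pairs
  blue. The strict inequality \<open>a < c\<close> absorbs both the larger independence ratio of
  \<open>R\<close> and the rounding of class sizes.\<close>

lemma eventually_large_purple:
  fixes X :: "'a set" and c :: real
  assumes wg: "weighted_graph X w E" and Kf: "K_free s X E"
    and ind: "indep_weight_le X w E a" and ac: "a < c" and \<epsilon>: "\<epsilon> > 0"
  shows "\<forall>\<^sub>F n in sequentially. \<exists>p\<in>good_purple_sizes n s (nat \<lceil>c * real n\<rceil>).
    (edge_weight X w E - \<epsilon>) * (real n)\<^sup>2 \<le> 2 * real p"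
proof -
  have sym: "\<And>x y. E x y \<Longrightarrow> E y x" and irr: "\<And>x. \<not> E x x"
    using wg by (auto simp: weighted_graph_def)
  \<comment> \<open>At most half of each margin is spent on the sparse subgraph. The rest keeps the
    limit inequalities strict, so that they hold for all large \<open>n\<close>.\<close>
  define \<delta> where "\<delta> = min (\<epsilon> / 2) ((c - a) / 2)"
  have \<delta>: "\<delta> > 0" "\<delta> \<le> \<epsilon> / 2" "a + \<delta> < c" using \<epsilon> ac by (auto simp: \<delta>_def min_def field_simps)
  obtain Y :: "('a \<times> nat \<times> (nat \<Rightarrow> nat)) set" and v R where
    Y: "weighted_graph Y v R" "fst ` Y \<subseteq> X" and RE: "\<forall>y z. R y z \<longrightarrow> E (fst y) (fst z)"
    and indR: "indep_weight_le Y v R (a + \<delta>)"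
    and dens: "edge_weight X w E - \<delta> \<le> edge_weight Y v (\<lambda>y z. E (fst y) (fst z) \<and> \<not> R y z)"
    using sparse_subgraph_of_blowup[OF wg ind \<delta>(1)] by (elim exE conjE) (rule that)
  define F where "F y z \<longleftrightarrow> E (fst y) (fst z) \<and> \<not> R y z" for y z
  have finY: "finite Y" and Rsym: "\<And>y z. R y z \<Longrightarrow> R z y" and Rirr: "\<And>y. \<not> R y y"
    and vnn: "\<forall>y\<in>Y. 0 \<le> v y" and vone: "sum v Y = 1"
    using Y(1) by (auto simp: weighted_graph_def)
  have Fsym: "F y z \<Longrightarrow> F z y" for y z using sym Rsym unfolding F_def by blast
  have Firr: "\<not> F y y" for y using irr by (auto simp: F_def)
  obtain \<phi> :: "nat \<Rightarrow> nat \<Rightarrow> 'a \<times> nat \<times> (nat \<Rightarrow> nat)" where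
    \<phi>': "\<forall>n. \<forall>i<n. \<phi> n i \<in> Y" and
    lim: "\<forall>y\<in>Y. (\<lambda>n. real (card {i. i < n \<and> \<phi> n i = y}) / real n) \<longlonglongrightarrow> v y"
    using map_with_fibre_proportions[OF finY vnn vone] by (elim exE conjE) (rule that)
  have \<phi>: "\<phi> n i \<in> Y" if "i < n" for n i using \<phi>' that by simp
  define f where "f n y = real (card {i. i < n \<and> \<phi> n i = y})" for n y
  have lim': "(\<lambda>n. f n y / real n) \<longlonglongrightarrow> v y" if "y \<in> Y" for y
    using lim that by (simp add: f_def)
  \<comment> \<open>\<open>Y\<close> has only finitely many independent sets, so one threshold for
    \<open>n\<close> serves all of them.\<close>
  have ev1: "\<forall>\<^sub>F n in sequentially. \<forall>J\<in>{J \<in> Pow Y. \<forall>y\<in>J. \<forall>z\<in>J. \<not> R y z}. (\<Sum>y\<in>J. f n y / real n) < c"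
  proof (rule eventually_ball_finite, simp add: finY, rule ballI)
    fix J assume J: "J \<in> {J \<in> Pow Y. \<forall>y\<in>J. \<forall>z\<in>J. \<not> R y z}"
    then have "sum v J \<le> a + \<delta>" using indR unfolding indep_weight_le_def by simp
    then have "sum v J < c" using \<delta>(3) by simp
    moreover have "(\<lambda>n. \<Sum>y\<in>J. f n y / real n) \<longlonglongrightarrow> sum v J"
      using J by (intro tendsto_sum lim') auto
    ultimately show "\<forall>\<^sub>F n in sequentially. (\<Sum>y\<in>J. f n y / real n) < c"
      by (rule order_tendstoD(2)[rotated])
  qed
  have "(\<lambda>n. edge_weight Y (\<lambda>y. f n y / real n) F) \<longlonglongrightarrow> edge_weight Y v F"
    unfolding edge_weight_def
  proof (intro tendsto_sum)
    fix y z assume "y \<in> Y" "z \<in> Y"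
    then show "(\<lambda>n. if F y z then f n y / real n * (f n z / real n) else 0)
        \<longlonglongrightarrow> (if F y z then v y * v z else 0)"
      using tendsto_mult[OF lim' lim'] by (cases "F y z") simp_all
  qed
  moreover have "edge_weight X w E - \<epsilon> < edge_weight Y v F"
    using dens \<delta> \<epsilon> unfolding F_def by linarith
  ultimately have ev2: "\<forall>\<^sub>F n in sequentially.
      edge_weight X w E - \<epsilon> < edge_weight Y (\<lambda>y. f n y / real n) F"
    by (rule order_tendstoD(1))
  show ?thesis
    using ev1 ev2 eventually_gt_at_top[of 0]
  proof eventually_elim
    case (elim n)
    define Rn where "Rn = pullback_edges n (\<phi> n) R"
    define Pn where "Pn = pullback_edges n (\<phi> n) F"
    define Bn where "Bn = complete_edges n - Rn - Pn"
    have Rsub: "Rn \<subseteq> complete_edges n" and Psub: "Pn \<subseteq> complete_edges n"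
      unfolding Rn_def Pn_def using Rirr Firr by (auto intro!: pullback_edges_subset)
    have RP: "Rn \<inter> Pn = {}"
    proof -
      have "e \<notin> Pn" if e: "e \<in> Rn" for e
      proof -
        obtain i j where ij: "e = {i, j}" "R (\<phi> n i) (\<phi> n j)"
          using e unfolding Rn_def pullback_edges_def by blast
        then have "\<not> F (\<phi> n i) (\<phi> n j)" by (simp add: F_def)
        then show ?thesis
          unfolding Pn_def ij(1) using doubleton_in_pullback_edges[of F i j n "\<phi> n", OF Fsym] by blast
      qed
      then show ?thesis by blast
    qed
    have col: "rbp_colouring n Rn Bn Pn"
      unfolding rbp_colouring_def Bn_def using Rsub Psub RP by blast
    have un: "Rn \<union> Pn = pullback_edges n (fst \<circ> \<phi> n) E"
      unfolding Rn_def Pn_def pullback_edges_def F_def comp_def using RE by blast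
    have noK: "\<not> contains_K n s (Rn \<union> Pn)"
      unfolding un using Y(2) \<phi> by (intro not_contains_K_pullback[OF Kf]) (auto intro: sym simp: irr)
    \<comment> \<open>A clique in blue and purple spans no red edge, so its image in
      \<open>Y\<close> is independent in \<open>R\<close>. The classes over that image have fewer
      than \<open>c * n\<close> elements in total, too few to contain the clique.\<close>
    have noI: "\<not> contains_K n (nat \<lceil>c * real n\<rceil>) (Bn \<union> Pn)"
    proof
      assume "contains_K n (nat \<lceil>c * real n\<rceil>) (Bn \<union> Pn)"
      then obtain S where S: "S \<subseteq> {..<n}" "card S = nat \<lceil>c * real n\<rceil>" "clique S (Bn \<union> Pn)"
        unfolding contains_K_def by blast
      have finS: "finite S" using S(1) finite_subset by blast
      define J where "J = \<phi> n ` S"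
      have JY: "J \<subseteq> Y" using S(1) \<phi> by (auto simp: J_def)
      have "\<not> R (\<phi> n i) (\<phi> n j)" if "i \<in> S" "j \<in> S" for i j
      proof (cases "i = j")
        case True then show ?thesis using Rirr by simp
      next
        case False
        then have "{i, j} \<in> Bn \<union> Pn" using S(3) that by (simp add: clique_def)
        then have "{i, j} \<notin> Rn" using RP by (auto simp: Bn_def)
        then show ?thesis
          unfolding Rn_def using doubleton_in_pullback_edges[of R i j n "\<phi> n", OF Rsym] that S(1) by blast
      qed
      then have "J \<in> {J \<in> Pow Y. \<forall>y\<in>J. \<forall>z\<in>J. \<not> R y z}" using JY by (auto simp: J_def)
      then have lt: "(\<Sum>y\<in>J. f n y / real n) < c" using elim(1) by blast
      have "S \<subseteq> (\<Union>y\<in>J. {i. i < n \<and> \<phi> n i = y})" using S(1) by (auto simp: J_def)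
      then have "card S \<le> card (\<Union>y\<in>J. {i. i < n \<and> \<phi> n i = y})"
        using finite_subset[OF JY finY] by (intro card_mono) auto
      also have "\<dots> \<le> (\<Sum>y\<in>J. card {i. i < n \<and> \<phi> n i = y})"
        using finite_subset[OF JY finY] by (rule card_UN_le)
      finally have "real (card S) \<le> (\<Sum>y\<in>J. f n y)" by (simp add: f_def flip: of_nat_sum)
      also have "\<dots> = (\<Sum>y\<in>J. f n y / real n) * real n"
        using elim(3) by (simp add: sum_divide_distrib[symmetric])
      also have "\<dots> < c * real n" using lt elim(3) by simp
      also have "\<dots> \<le> real (card S)" unfolding S(2) by linarith
      finally show False by simp
    qed
    have "(edge_weight X w E - \<epsilon>) * (real n)\<^sup>2 \<le> edge_weight Y (\<lambda>y. f n y / real n) F * (real n)\<^sup>2"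
      using elim(2) by (intro mult_right_mono) auto
    also have "\<dots> = edge_weight Y (f n) F"
      unfolding edge_weight_def sum_distrib_right using elim(3)
      by (intro sum.cong) (auto simp: power2_eq_square)
    also have "\<dots> = 2 * real (card Pn)"
      unfolding Pn_def f_def using card_pullback_edges[of Y n "\<phi> n" F, OF finY \<phi> Fsym Firr] by simp
    finally have "(edge_weight X w E - \<epsilon>) * (real n)\<^sup>2 \<le> 2 * real (card Pn)" .
    moreover have "card Pn \<in> good_purple_sizes n s (nat \<lceil>c * real n\<rceil>)"
      unfolding good_purple_sizes_def using col noK noI by blast
    ultimately show ?case by blast
  qed
qed

section \<open>Disjoint unions\<close>

fun union_adj :: "('a \<Rightarrow> 'a \<Rightarrow> bool) \<Rightarrow> ('b \<Rightarrow> 'b \<Rightarrow> bool) \<Rightarrow> 'a + 'b \<Rightarrow> 'a + 'b \<Rightarrow> bool" where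
  "union_adj E F (Inl x) (Inl y) \<longleftrightarrow> E x y"
| "union_adj E F (Inr x) (Inr y) \<longleftrightarrow> F x y"
| "union_adj E F (Inl x) (Inr y) \<longleftrightarrow> False"
| "union_adj E F (Inr x) (Inl y) \<longleftrightarrow> False"

definition union_weight :: "real \<Rightarrow> ('a \<Rightarrow> real) \<Rightarrow> ('b \<Rightarrow> real) \<Rightarrow> 'a + 'b \<Rightarrow> real" where
  "union_weight \<delta> w v = case_sum (\<lambda>x. (1 - \<delta>) * w x) (\<lambda>y. \<delta> * v y)"

lemma sum_union_weight:
  assumes "finite A" and "finite B"
  shows "sum (union_weight \<delta> w v) (A <+> B) = (1 - \<delta>) * sum w A + \<delta> * sum v B"
  using assms by (simp add: sum.Plus union_weight_def sum_distrib_left comp_def)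

lemma weighted_graph_union:
  assumes "weighted_graph X w E" and "weighted_graph Y v F" and "0 \<le> \<delta>" "\<delta> \<le> 1"
  shows "weighted_graph (X <+> Y) (union_weight \<delta> w v) (union_adj E F)"
proof -
  have "union_adj E F b a" if "union_adj E F a b" for a b
    using that assms(1,2) by (cases a; cases b) (auto simp: weighted_graph_def)
  moreover have "\<not> union_adj E F a a" for a
    using assms(1,2) by (cases a) (auto simp: weighted_graph_def)
  moreover have "0 \<le> union_weight \<delta> w v a" if "a \<in> X <+> Y" for a
    using that assms by (auto simp: weighted_graph_def union_weight_def)
  moreover have "sum (union_weight \<delta> w v) (X <+> Y) = 1"
    using assms(1,2) by (simp add: sum_union_weight weighted_graph_def)
  ultimately show ?thesis using assms(1,2) unfolding weighted_graph_def by simp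
qed

lemma indep_weight_le_union:
  assumes "weighted_graph X w E" and "weighted_graph Y v F" and \<delta>: "0 \<le> \<delta>" "\<delta> \<le> 1"
    and a: "indep_weight_le X w E a" and b: "indep_weight_le Y v F b"
  shows "indep_weight_le (X <+> Y) (union_weight \<delta> w v) (union_adj E F) ((1 - \<delta>) * a + \<delta> * b)"
  unfolding indep_weight_le_def
proof (intro allI impI)
  fix I assume I: "I \<subseteq> X <+> Y" and ind: "\<forall>x\<in>I. \<forall>y\<in>I. \<not> union_adj E F x y"
  let ?A = "Inl -` I" and ?B = "Inr -` I"
  note split = subset_Plus_split[OF I]
  have fin: "finite X" "finite Y" using assms(1,2) by (auto simp: weighted_graph_def)
  have "\<not> E x y" if "x \<in> ?A" "y \<in> ?A" for x y using ind that by force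
  then have A: "sum w ?A \<le> a" using a split(2) unfolding indep_weight_le_def by simp
  have "\<not> F x y" if "x \<in> ?B" "y \<in> ?B" for x y using ind that by force
  then have B: "sum v ?B \<le> b" using b split(3) unfolding indep_weight_le_def by simp
  have "sum (union_weight \<delta> w v) I = sum (union_weight \<delta> w v) (?A <+> ?B)"
    using split(1) by metis
  also have "\<dots> = (1 - \<delta>) * sum w ?A + \<delta> * sum v ?B"
    using finite_subset[OF split(2) fin(1)] finite_subset[OF split(3) fin(2)]
    by (rule sum_union_weight)
  also have "\<dots> \<le> (1 - \<delta>) * a + \<delta> * b"
    using A B \<delta> by (intro add_mono mult_left_mono) auto
  finally show "sum (union_weight \<delta> w v) I \<le> (1 - \<delta>) * a + \<delta> * b" .
qed

lemma K_free_union: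
  assumes "K_free s X E" and "K_free s Y F"
  shows "K_free s (X <+> Y) (union_adj E F)"
  unfolding K_free_def
proof (intro allI impI, rule ccontr)
  fix S assume S: "S \<subseteq> X <+> Y" "card S = s"
    and no: "\<not> (\<exists>x\<in>S. \<exists>y\<in>S. x \<noteq> y \<and> \<not> union_adj E F x y)"
  have adj: "union_adj E F x y" if "x \<in> S" "y \<in> S" "x \<noteq> y" for x y using no that by blast
  have sides: "S \<subseteq> range Inl \<or> S \<subseteq> range Inr"
  proof (rule ccontr)
    assume "\<not> ?thesis"
    then obtain p q where "p \<in> S" "q \<in> S" "p \<notin> range Inl" "q \<notin> range Inr" by blast
    moreover obtain y x where "p = Inr y" "q = Inl x"
      using calculation by (metis range_eqI sum.exhaust)
    ultimately show False using adj[of p q] by simp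
  qed
  then show False
  proof
    assume "S \<subseteq> range Inl"
    then have eq: "S = Inl ` (Inl -` S)" by auto
    then have "card (Inl -` S) = s" by (metis S(2) card_image inj_Inl)
    moreover have "Inl -` S \<subseteq> X" using S(1) by auto
    ultimately obtain x y where "Inl x \<in> S" "Inl y \<in> S" "x \<noteq> y" "\<not> E x y"
      using assms(1) unfolding K_free_def by (metis vimageE)
    then show False using adj[of "Inl x" "Inl y"] by simp
  next
    assume "S \<subseteq> range Inr"
    then have eq: "S = Inr ` (Inr -` S)" by auto
    then have "card (Inr -` S) = s" by (metis S(2) card_image inj_Inr)
    moreover have "Inr -` S \<subseteq> Y" using S(1) by auto
    ultimately obtain x y where "Inr x \<in> S" "Inr y \<in> S" "x \<noteq> y" "\<not> F x y"
      using assms(2) unfolding K_free_def by (metis vimageE)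
    then show False using adj[of "Inr x" "Inr y"] by simp
  qed
qed

text \<open>The edges inside \<open>Y\<close> are given away: that part is there for its
  independence ratio, and its weight will be small.\<close>

lemma edge_weight_union_ge:
  assumes "weighted_graph X w E" and "weighted_graph Y v F" and "0 \<le> \<delta>" "\<delta> \<le> 1"
  shows "(1 - \<delta>)\<^sup>2 * edge_weight X w E \<le>
    edge_weight (X <+> Y) (union_weight \<delta> w v) (union_adj E F)"
proof -
  have fin: "finite X" "finite Y" using assms(1,2) by (auto simp: weighted_graph_def)
  let ?u = "union_weight \<delta> w v" and ?U = "union_adj E F"
  have nn: "0 \<le> ?u a" if "a \<in> X <+> Y" for a
    using weighted_graph_union[OF assms] that by (auto simp: weighted_graph_def)
  have "(1 - \<delta>)\<^sup>2 * edge_weight X w E =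
      (\<Sum>x\<in>X. \<Sum>y\<in>X. if ?U (Inl x) (Inl y) then ?u (Inl x) * ?u (Inl y) else 0)"
    unfolding edge_weight_def sum_distrib_left
    by (intro sum.cong) (auto simp: union_weight_def power2_eq_square)
  also have "\<dots> = (\<Sum>a\<in>Inl ` X. \<Sum>b\<in>Inl ` X. if ?U a b then ?u a * ?u b else 0)"
    by (simp add: sum.reindex)
  also have "\<dots> \<le> (\<Sum>a\<in>Inl ` X. \<Sum>b\<in>X <+> Y. if ?U a b then ?u a * ?u b else 0)"
    using fin nn by (intro sum_mono sum_mono2) auto
  also have "\<dots> \<le> edge_weight (X <+> Y) ?u ?U"
    unfolding edge_weight_def using fin
    by (intro sum_mono2) (auto intro!: sum_nonneg mult_nonneg_nonneg nn)
  finally show ?thesis .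
qed

section \<open>Ramsey-Turan graphs and purple edges\<close>

text \<open>Kept apart from \<open>RT\<close> because nonemptiness has to be tracked: a
  \<open>Max\<close> over the empty set carries no information.\<close>

definition RT_graphs :: "nat \<Rightarrow> real \<Rightarrow> nat \<Rightarrow> nat set set set" where
  "RT_graphs s t n = {E. E \<subseteq> complete_edges n \<and> \<not> contains_K n s E \<and>
      real (independence_number n E) < t}"

lemma finite_RT_graphs: "finite (RT_graphs s t n)"
  by (rule finite_subset[of _ "Pow (complete_edges n)"])
    (auto simp: RT_graphs_def finite_complete_edges)

lemma RT_eq: "RT s t n = Max (card ` RT_graphs s t n)"
  unfolding RT_def RT_graphs_def by (rule arg_cong[of _ _ Max]) auto

lemma card_le_independence_number:
  assumes "S \<subseteq> {..<n}" and "indep S E"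
  shows "card S \<le> independence_number n E"
  unfolding independence_number_def
proof (rule Max_ge)
  show "finite {card S |S. S \<subseteq> {..<n} \<and> indep S E}"
    by (rule finite_subset[of _ "card ` Pow {..<n}"]) auto
qed (use assms in blast)

lemma independence_number_attained:
  "\<exists>S\<subseteq>{..<n}. indep S E \<and> card S = independence_number n E"
proof -
  have "independence_number n E \<in> {card S |S. S \<subseteq> {..<n} \<and> indep S E}"
    unfolding independence_number_def
  proof (rule Max_in)
    show "finite {card S |S. S \<subseteq> {..<n} \<and> indep S E}"
      by (rule finite_subset[of _ "card ` Pow {..<n}"]) auto
    have "indep {} E" by simp
    then show "{card S |S. S \<subseteq> {..<n} \<and> indep S E} \<noteq> {}" by blast
  qed
  then show ?thesis by auto
qed

text \<open>The witness is \<open>R \<union> P\<close>. A set independent in it spans only blue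
  edges, hence is a clique in \<open>B \<union> P\<close>.\<close>

lemma good_purple_RT_graph:
  assumes "p \<in> good_purple_sizes n s (nat \<lceil>t\<rceil>)"
  shows "\<exists>E\<in>RT_graphs s t n. p \<le> card E"
proof -
  obtain R B P where c: "rbp_colouring n R B P" and p: "p = card P"
    and s: "\<not> contains_K n s (R \<union> P)" and t: "\<not> contains_K n (nat \<lceil>t\<rceil>) (B \<union> P)"
    using assms by (auto simp: good_purple_sizes_def)
  have sub: "R \<union> P \<subseteq> complete_edges n" using c by (auto simp: rbp_colouring_def)
  have "real (independence_number n (R \<union> P)) < t"
  proof (rule ccontr)
    assume "\<not> ?thesis"
    \<comment> \<open>The independence number is an integer, so reaching \<open>t\<close> means
      reaching \<open>t\<close> rounded up.\<close>
    then have "nat \<lceil>t\<rceil> \<le> independence_number n (R \<union> P)" by (simp add: nat_le_iff ceiling_le_iff)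
    moreover obtain S where S: "S \<subseteq> {..<n}" "indep S (R \<union> P)" "card S = independence_number n (R \<union> P)"
      using independence_number_attained by blast
    ultimately obtain S' where S': "S' \<subseteq> S" "card S' = nat \<lceil>t\<rceil>"
      by (metis obtain_subset_with_card_n)
    have "clique S' (B \<union> P)"
      unfolding clique_def
    proof (intro ballI impI)
      fix i j assume ij: "i \<in> S'" "j \<in> S'" "i \<noteq> j"
      then have "{i, j} \<in> complete_edges n" using S S' by (auto simp: complete_edges_def)
      moreover have "{i, j} \<notin> R \<union> P" using S(2) S'(1) ij unfolding indep_def by blast
      ultimately show "{i, j} \<in> B \<union> P" using c unfolding rbp_colouring_def by blast
    qed
    then show False using t S S' unfolding contains_K_def by blast
  qed
  then have "R \<union> P \<in> RT_graphs s t n" using s sub by (simp add: RT_graphs_def)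
  moreover have "card P \<le> card (R \<union> P)"
    using sub finite_complete_edges finite_subset by (intro card_mono) blast+
  ultimately show ?thesis using p by blast
qed

text \<open>The witness \<open>p\<close> makes the sets behind both maxima nonempty, so
  \<open>g\<close> and \<open>RT\<close> are attained and can be compared.\<close>

lemma g_le_RT:
  assumes "p \<in> good_purple_sizes n s (nat \<lceil>t\<rceil>)"
  shows "p \<le> g n (real s) t" and "g n (real s) t \<le> RT s t n" and "RT_graphs s t n \<noteq> {}"
proof -
  show "p \<le> g n (real s) t"
    using assms finite_good_purple_sizes by (simp add: g_def)
  have "g n (real s) t \<in> good_purple_sizes n s (nat \<lceil>t\<rceil>)"
    using Max_in[OF finite_good_purple_sizes, of n s "nat \<lceil>t\<rceil>"] assms by (auto simp: g_def)
  then obtain E where "E \<in> RT_graphs s t n" "g n (real s) t \<le> card E"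
    using good_purple_RT_graph by blast
  then show "g n (real s) t \<le> RT s t n" "RT_graphs s t n \<noteq> {}"
    using Max_ge[of "card ` RT_graphs s t n" "card E"] finite_RT_graphs unfolding RT_eq by fastforce+
qed

text \<open>This turns an extremal graph on \<open>n\<close> vertices into an ingredient for the
  weighted constructions.\<close>

lemma RT_weighted_graph:
  assumes "E \<in> RT_graphs s t n" and "n > 0"
  shows "weighted_graph {..<n} (\<lambda>_. 1 / real n) (\<lambda>i j. {i, j} \<in> E)"
    and "K_free s {..<n} (\<lambda>i j. {i, j} \<in> E)"
    and "indep_weight_le {..<n} (\<lambda>_. 1 / real n) (\<lambda>i j. {i, j} \<in> E) (t / real n)"
    and "edge_weight {..<n} (\<lambda>_. 1 / real n) (\<lambda>i j. {i, j} \<in> E) = 2 * real (card E) / (real n)\<^sup>2"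
proof -
  have sub: "E \<subseteq> complete_edges n" and K: "\<not> contains_K n s E"
    and ind: "real (independence_number n E) < t"
    using assms(1) by (auto simp: RT_graphs_def)
  have edge: "i < n \<and> j < n \<and> i \<noteq> j" if "{i, j} \<in> E" for i j
  proof -
    have "{i, j} \<in> [{..<n}]\<^bsup>2\<^esup>" using that sub unfolding complete_edges_def by blast
    then show ?thesis by simp
  qed
  have irr: "{i} \<notin> E" for i using edge[of i i] by auto
  show "weighted_graph {..<n} (\<lambda>_. 1 / real n) (\<lambda>i j. {i, j} \<in> E)"
    using assms(2) irr by (simp add: weighted_graph_def insert_commute)
  show "K_free s {..<n} (\<lambda>i j. {i, j} \<in> E)"
    using K unfolding K_free_def contains_K_def clique_def by blast
  show "indep_weight_le {..<n} (\<lambda>_. 1 / real n) (\<lambda>i j. {i, j} \<in> E) (t / real n)"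
    unfolding indep_weight_le_def
  proof (intro allI impI)
    fix I assume "I \<subseteq> {..<n}" "\<forall>i\<in>I. \<forall>j\<in>I. {i, j} \<notin> E"
    then have "card I \<le> independence_number n E"
      by (intro card_le_independence_number) (auto simp: indep_def)
    then have "real (card I) \<le> t" using ind by linarith
    then show "(\<Sum>i\<in>I. 1 / real n) \<le> t / real n" by (simp add: divide_right_mono)
  qed
  have "{(i, j). {i, j} \<in> E} = Sigma {..<n} (\<lambda>i. {j \<in> {..<n}. {i, j} \<in> E})"
    using edge by auto
  then have "2 * card E = (\<Sum>i<n. card {j \<in> {..<n}. {i, j} \<in> E})"
    using card_ordered_edges[OF sub] by (simp add: card_SigmaI)
  then have "2 * real (card E) = (\<Sum>i<n. real (card {j \<in> {..<n}. {i, j} \<in> E}))"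
    by (simp flip: of_nat_sum)
  then show "edge_weight {..<n} (\<lambda>_. 1 / real n) (\<lambda>i j. {i, j} \<in> E) = 2 * real (card E) / (real n)\<^sup>2"
    unfolding edge_weight_def
    by (simp add: sum.If_cases Int_def sum_divide_distrib power2_eq_square)
qed

text \<open>\<open>L\<close> is the upper limit, obtained as the infimum of all eventual upper
  bounds; 1 is such a bound and none is negative. Values near \<open>L\<close> will supply the graph
  to be blown up, and the bound above \<open>L\<close> controls all large \<open>n\<close>.\<close>

lemma limsup_approximation:
  fixes r :: "nat \<Rightarrow> real"
  assumes "\<forall>\<^sub>F n in sequentially. 0 \<le> r n \<and> r n \<le> 1" and "\<eta> > 0"
  shows "\<exists>L. (\<forall>\<^sub>F n in sequentially. r n \<le> L + \<eta>) \<and> (\<exists>\<^sub>F n in sequentially. L - \<eta> < r n)"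
proof -
  define S where "S = {l. \<forall>\<^sub>F n in sequentially. r n \<le> l}"
  have "1 \<in> S" using assms(1) unfolding S_def by (auto elim: eventually_mono)
  have "0 \<le> l" if "l \<in> S" for l
  proof -
    have "\<forall>\<^sub>F n in sequentially. r n \<le> l \<and> 0 \<le> r n \<and> r n \<le> 1"
      using that assms(1) by (auto simp: S_def intro: eventually_conj)
    then obtain n where "r n \<le> l \<and> 0 \<le> r n"
      using eventually_happens'[OF sequentially_bot] by blast
    then show ?thesis by simp
  qed
  then have bdd: "bdd_below S" by (auto simp: bdd_below_def)
  obtain l where "l \<in> S" "l < Inf S + \<eta>"
    using cInf_lessD[of S "Inf S + \<eta>"] \<open>1 \<in> S\<close> assms(2) by auto
  then have "\<forall>\<^sub>F n in sequentially. r n \<le> Inf S + \<eta>"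
    unfolding S_def by (auto elim!: eventually_mono)
  moreover have "Inf S - \<eta> \<notin> S" using cInf_lower[OF _ bdd] assms(2) by fastforce
  then have "\<exists>\<^sub>F n in sequentially. Inf S - \<eta> < r n"
    by (simp add: S_def not_eventually not_le)
  ultimately show ?thesis by blast
qed

theorem theorem1p3:
  fixes s :: nat
  assumes "s \<ge> 3"
  shows "\<exists>c0 > 0. \<forall>c :: real. 0 < c \<and> c < c0 \<longrightarrow>
    (\<exists>\<epsilon> :: nat \<Rightarrow> real. \<epsilon> \<in> o(\<lambda>_. 1) \<and>
      (\<forall>\<^sub>F n in sequentially.
        real (g n (real s) (c * real n)) = (1 - \<epsilon> n) * real (RT s (c * real n) n)))"
\<comment> \<open>Every \<open>c\<close> below 1 is small enough: the auxiliary graph has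
  independence ratio at most \<open>c / 2 < 1\<close>, hence positive edge weight.\<close>
proof (intro exI[of _ 1] conjI allI impI)
  show "(0::real) < 1" by simp
  fix c :: real assume c: "0 < c \<and> c < 1"
  \<comment> \<open>This graph serves twice: blown up alone it shows that \<open>g\<close> is at
    least quadratic in \<open>n\<close>, and as a small disjoint part it lowers the independence
    ratio of an extremal graph.\<close>
  obtain X :: "nat set" and w F where wg: "weighted_graph X w F" and tf: "triangle_free X F"
    and ind: "indep_weight_le X w F (c / 2)"
    using triangle_free_small_independence[of "c / 2"] c by auto
  have Kf: "K_free s X F" using triangle_free_imp_K_free[OF tf assms] .
  \<comment> \<open>A quarter: half of the edge weight is allowed as loss, and the other half counts
    every purple edge twice.\<close>
  define \<kappa> where "\<kappa> = edge_weight X w F / 4"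
  have \<kappa>: "\<kappa> > 0" using edge_weight_pos[OF wg ind] c by (simp add: \<kappa>_def)
  let ?g = "\<lambda>n. real (g n (real s) (c * real n))" and ?RT = "\<lambda>n. real (RT s (c * real n) n)"
  have "\<forall>\<^sub>F n in sequentially. \<exists>p\<in>good_purple_sizes n s (nat \<lceil>c * real n\<rceil>).
      (edge_weight X w F - 2 * \<kappa>) * (real n)\<^sup>2 \<le> 2 * real p"
    using eventually_large_purple[OF wg Kf ind] c \<kappa> by simp
  then have pos: "\<forall>\<^sub>F n in sequentially. \<kappa> * (real n)\<^sup>2 \<le> ?g n \<and> ?g n \<le> ?RT n \<and>
      RT_graphs s (c * real n) n \<noteq> {}"
  proof eventually_elim
    case (elim n)
    then obtain p where p: "p \<in> good_purple_sizes n s (nat \<lceil>c * real n\<rceil>)"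
      and le: "(edge_weight X w F - 2 * \<kappa>) * (real n)\<^sup>2 \<le> 2 * real p" by blast
    have "\<kappa> * (real n)\<^sup>2 \<le> real p" using le by (simp add: \<kappa>_def)
    then show ?case using g_le_RT[OF p] by auto
  qed
  define r where "r n = 2 * ?RT n / (real n)\<^sup>2" for n
  have attained: "\<exists>E\<in>RT_graphs s (c * real n) n. card E = RT s (c * real n) n"
    if "RT_graphs s (c * real n) n \<noteq> {}" for n
    using Max_in[of "card ` RT_graphs s (c * real n) n"] that finite_RT_graphs
    unfolding RT_eq by fastforce
  have r1: "r n \<le> 1" if n: "n > 0" and ne: "RT_graphs s (c * real n) n \<noteq> {}" for n
  proof -
    obtain E where E: "E \<in> RT_graphs s (c * real n) n" "card E = RT s (c * real n) n"
      using attained[OF ne] by blast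
    show ?thesis
      using edge_weight_le_1[OF RT_weighted_graph(1)[OF E(1) n]]
        RT_weighted_graph(4)[OF E(1) n] E(2) by (simp add: r_def)
  qed
  have r_bounds: "\<forall>\<^sub>F n in sequentially. 0 \<le> r n \<and> r n \<le> 1"
    using pos eventually_gt_at_top[of 0]
  proof eventually_elim
    case (elim n)
    then show ?case using r1[of n] by (simp add: r_def)
  qed
  \<comment> \<open>In the scale of \<open>r\<close>, the fixed graph has density above
    \<open>L - \<eta>\<close>, the disjoint union costs at most \<open>2 * \<eta>\<close> and the
    colouring \<eta>. So \<open>g\<close> reaches \<open>L - 4 * \<eta>\<close>, while
    \<open>RT\<close> stays within \<open>L + \<eta>\<close>. The gap of \<open>5 * \<eta>\<close>
    is halved because \<open>r\<close> counts each edge twice.\<close>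
  have close: "\<forall>\<^sub>F n in sequentially. ?RT n - ?g n \<le> 5 / 2 * \<eta> * (real n)\<^sup>2"
    if \<eta>: "0 < \<eta>" "\<eta> < 1" for \<eta>
  proof -
    obtain L where up: "\<forall>\<^sub>F n in sequentially. r n \<le> L + \<eta>"
      and fr: "\<exists>\<^sub>F n in sequentially. L - \<eta> < r n"
      using limsup_approximation[OF r_bounds \<eta>(1)] by blast
    have "\<forall>\<^sub>F n in sequentially. RT_graphs s (c * real n) n \<noteq> {} \<and> n > 0"
      using pos eventually_gt_at_top[of 0] by eventually_elim auto
    \<comment> \<open>\<open>m\<close> stays fixed from here on while \<open>n\<close> tends to
      infinity; it must be one of the infinitely many near the upper limit for which extremal graphs
      exist.\<close>
    then obtain m where m: "L - \<eta> < r m" "RT_graphs s (c * real m) m \<noteq> {}" "m > 0"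
      using frequently_ex[OF frequently_eventually_conj[OF fr]] by blast
    obtain E where E: "E \<in> RT_graphs s (c * real m) m" "card E = RT s (c * real m) m"
      using attained[OF m(2)] by blast
    note G = RT_weighted_graph[OF E(1) m(3)]
    let ?E = "\<lambda>i j. {i, j} \<in> E" and ?w = "\<lambda>_::nat. 1 / real m"
    have \<eta>': "0 \<le> \<eta>" "\<eta> \<le> 1" using \<eta> by auto
    have indG: "indep_weight_le {..<m} ?w ?E c" using G(3) m(3) by simp
    \<comment> \<open>The union creates the strictness: for the extremal graph alone only the bound
      \<open>c\<close> is at hand, which leaves no room for the loss in
      \<open>eventually_large_purple\<close>.\<close>
    have lt: "(1 - \<eta>) * c + \<eta> * (c / 2) < c" using \<eta> c by (simp add: algebra_simps)
    have "K_free s ({..<m} <+> X) (union_adj ?E F)"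
      using K_free_union[OF G(2) Kf] .
    note ev = eventually_large_purple[OF weighted_graph_union[OF G(1) wg \<eta>'] this
        indep_weight_le_union[OF G(1) wg \<eta>' indG ind] lt \<eta>(1)]
    have rm: "0 \<le> r m" "r m \<le> 1" using r1 m by (auto simp: r_def)
    have "r m - 2 * \<eta> \<le> (1 - \<eta>)\<^sup>2 * r m"
    proof -
      have "2 * \<eta> * r m \<le> 2 * \<eta> * 1" using rm \<eta> by (intro mult_left_mono) auto
      moreover have "0 \<le> \<eta>\<^sup>2 * r m" using rm by simp
      ultimately show ?thesis by (simp add: power2_eq_square algebra_simps)
    qed
    also have "\<dots> \<le> edge_weight ({..<m} <+> X) (union_weight \<eta> ?w w) (union_adj ?E F)"
      using edge_weight_union_ge[OF G(1) wg \<eta>'] G(4) E(2) by (simp add: r_def)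
    finally have dens: "L - 4 * \<eta> \<le>
        edge_weight ({..<m} <+> X) (union_weight \<eta> ?w w) (union_adj ?E F) - \<eta>"
      using m(1) by linarith
    show ?thesis
      using ev up eventually_gt_at_top[of 0]
    proof eventually_elim
      case (elim n)
      then obtain p where p: "p \<in> good_purple_sizes n s (nat \<lceil>c * real n\<rceil>)"
        and le: "(edge_weight ({..<m} <+> X) (union_weight \<eta> ?w w) (union_adj ?E F) - \<eta>) *
          (real n)\<^sup>2 \<le> 2 * real p" by blast
      have "(L - 4 * \<eta>) * (real n)\<^sup>2 \<le> 2 * real p"
        using mult_right_mono[OF dens, of "(real n)\<^sup>2"] le by simp
      moreover have "2 * ?RT n \<le> (L + \<eta>) * (real n)\<^sup>2"
        using elim by (simp add: r_def divide_le_eq)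
      moreover have "real p \<le> ?g n" using g_le_RT(1)[OF p] by simp
      ultimately show ?case by (simp add: algebra_simps)
    qed
  qed
  \<comment> \<open>By \<open>pos\<close>, the denominator is eventually positive, and there the
    required identity holds by construction.\<close>
  define \<epsilon> where "\<epsilon> n = 1 - ?g n / ?RT n" for n
  have "\<epsilon> \<longlonglongrightarrow> 0"
  proof (rule tendstoI)
    fix e :: real assume e: "0 < e"
    \<comment> \<open>Then \<open>5 / 2 * \<eta>\<close> is at most \<open>\<kappa> * e / 2\<close>,
      and since \<open>RT\<close> is at least \<open>\<kappa> * n^2\<close>, the gap is at most half
      of \<open>e\<close> times \<open>RT\<close>. The cap \<open>1 / 2\<close> ensures the
      condition \<open>\<eta> < 1\<close> of \<open>close\<close>.\<close>
    define \<eta> where "\<eta> = min (1 / 2) (\<kappa> * e / 5)"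
    have \<eta>: "0 < \<eta>" "\<eta> < 1" "\<eta> \<le> \<kappa> * e / 5" using \<kappa> e by (auto simp: \<eta>_def)
    show "\<forall>\<^sub>F n in sequentially. dist (\<epsilon> n) 0 < e"
      using close[OF \<eta>(1,2)] pos eventually_gt_at_top[of 0]
    proof eventually_elim
      case (elim n)
      have n2: "(real n)\<^sup>2 > 0" using elim by simp
      have RT: "\<kappa> * (real n)\<^sup>2 \<le> ?RT n" using elim by simp
      have RT0: "?RT n > 0" using RT mult_pos_pos[OF \<kappa> n2] by linarith
      have "?RT n - ?g n \<le> 5 / 2 * \<eta> * (real n)\<^sup>2" using elim by simp
      also have "\<dots> \<le> 5 / 2 * (\<kappa> * e / 5) * (real n)\<^sup>2"
        using \<eta>(3) n2 by (intro mult_right_mono mult_left_mono) auto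
      also have "\<dots> = e / 2 * (\<kappa> * (real n)\<^sup>2)" by simp
      also have "\<dots> \<le> e / 2 * ?RT n" using RT e by (intro mult_left_mono) auto
      also have "\<dots> < e * ?RT n" using RT0 e by simp
      finally have "(?RT n - ?g n) / ?RT n < e" using RT0 by (simp add: divide_less_eq)
      moreover have "\<epsilon> n = (?RT n - ?g n) / ?RT n" using RT0 by (simp add: \<epsilon>_def diff_divide_distrib)
      moreover have "0 \<le> (?RT n - ?g n) / ?RT n" using elim by simp
      ultimately show ?case by simp
    qed
  qed
  then have "\<epsilon> \<in> o(\<lambda>_. 1)" by (intro smalloI_tendsto) auto
  moreover have "\<forall>\<^sub>F n in sequentially. ?g n = (1 - \<epsilon> n) * ?RT n"
    using pos eventually_gt_at_top[of 0]
  proof eventually_elim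
    case (elim n)
    have "?RT n > 0" using elim mult_pos_pos[OF \<kappa>, of "(real n)\<^sup>2"] by simp
    then show ?case by (simp add: \<epsilon>_def)
  qed
  ultimately show "\<exists>\<epsilon> :: nat \<Rightarrow> real. \<epsilon> \<in> o(\<lambda>_. 1) \<and>
      (\<forall>\<^sub>F n in sequentially. ?g n = (1 - \<epsilon> n) * ?RT n)" by blast
qed

end
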